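(* Let $2\le r<\infty$. Assume that the observations are independent across clusters (with arbitrary dependence within clusters), that $$\frac{\big(\sum_{g=1}^{G}n_g^r\big)^{2/r}}{n}\le C<\infty\quad\text{and}\quad \max_{g\in[G]}\frac{n_g^2}{n}\to0\quad (n\to\infty),$$ and that $$\lim_{M\to\infty}\sup_{n}\sup_{i,j\le n}E\big[|\varphi(W_i,W_j)|^r\,1\{|\varphi(W_i,W_j)|>M\}\big]=0 .$$ Then, as $n\to\infty$: (a) $\displaystyle U_{n,2}=\frac2n\sum_{i=1}^n\bar\varphi_n(W_i)+O_p\Big(\frac{m_n}{n}\Big)$; (b) $\displaystyle U_{n,2}=O_p\Big(\sqrt{\frac{m_n}{n}}\Big)=o_p(1)$. (c) If, in addition, $\sigma_{n,2}\ge\lambda>0$ for a constant $\lambda$ not depending on $n$, then $\sigma_{n,2}^{-1}\sqrt n\,U_{n,2}\xrightarrow{d}\mathcal N(0,1)$.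
   Context: For each $n$, the index set $[n]=\{1,\dots,n\}$ is partitioned into $G=G_n$ clusters $\mathcal G_1,\dots,\mathcal G_G$, with $n_g=\#\mathcal G_g$, $m_n=\max_{g\in[G]}n_g$, and $g(i)$ the cluster of unit $i$. The observations $W_1,\dots,W_n$ are random elements of a standard Borel space; "independent across clusters" means that the arrays $\{W_i\}_{i\in\mathcal G_g}$, $g\in[G]$, are mutually independent. The kernel $\varphi$ is real-valued, measurable, symmetric in its two arguments, and centred on cross-cluster pairs: $E[\varphi(W_i,W_j)]=0$ whenever $g(i)\ne g(j)$. No centring is imposed on within-cluster pairs. $U_{n,2}=\frac{1}{n(n-1)}\sum_{i=1}^n\sum_{j\ne i}\varphi(W_i,W_j)$. $\varphi^{(1)}_j(W_i)=E[\varphi(W_i,W_j)\mid W_i]$, and $\bar\varphi_n(W_i)=\frac{1}{n-n_{g(i)}}\sum_{j=1}^n 1\{j\notin\mathcal G_{g(i)}\}\,\varphi^{(1)}_j(W_i)$ (well defined for all sufficiently large $n$). $\sigma_{n,2}\ge 0$ is given by $\sigma_{n,2}^2=\frac4n\sum_{g=1}^G E\big[\big(\sum_{i\in\mathcal G_g}\bar\varphi_n(W_i)\big)^2\big]$. *)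

theory Defs
  imports "HOL-Probability.Probability"
begin

definition standard_borel :: "'a measure \<Rightarrow> bool" where
  "standard_borel S \<longleftrightarrow>
     (\<exists>X. completely_metrizable_space X \<and> second_countable X \<and> topspace X = space S \<and>
          sets S = sigma_sets (topspace X) {U. openin X U})"

text \<open>
  The constants below are relative to one fixed sample size \<open>n\<close>. The cluster map
  \<open>g\<close> sends a unit \<open>i \<in> {1..n}\<close> to the label \<open>g i \<in> {1..G}\<close> of its cluster, so that the
  clusters are the fibres of \<open>g\<close>.
\<close>

definition cluster :: "nat \<Rightarrow> (nat \<Rightarrow> nat) \<Rightarrow> nat \<Rightarrow> nat set" where
  "cluster n g k = {i \<in> {1..n}. g i = k}"

definition cluster_size :: "nat \<Rightarrow> (nat \<Rightarrow> nat) \<Rightarrow> nat \<Rightarrow> nat" where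
  "cluster_size n g k = card (cluster n g k)"

definition max_cluster_size :: "nat \<Rightarrow> (nat \<Rightarrow> nat) \<Rightarrow> nat \<Rightarrow> nat" where
  "max_cluster_size n g G = (MAX k\<in>{1..G}. cluster_size n g k)"

definition indep_across_clusters ::
  "'w measure \<Rightarrow> 'a measure \<Rightarrow> (nat \<Rightarrow> 'w \<Rightarrow> 'a) \<Rightarrow> nat \<Rightarrow> (nat \<Rightarrow> nat) \<Rightarrow> nat \<Rightarrow> bool" where
  "indep_across_clusters M S W n g G \<longleftrightarrow>
     prob_space.indep_vars M (\<lambda>k. PiM (cluster n g k) (\<lambda>_. S))
       (\<lambda>k \<omega>. \<lambda>i\<in>cluster n g k. W i \<omega>) {1..G}"

definition U_stat :: "('a \<Rightarrow> 'a \<Rightarrow> real) \<Rightarrow> (nat \<Rightarrow> 'w \<Rightarrow> 'a) \<Rightarrow> nat \<Rightarrow> 'w \<Rightarrow> real" where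
  "U_stat \<phi> W n \<omega> =
     1 / (real n * (real n - 1)) * (\<Sum>i\<in>{1..n}. \<Sum>j\<in>{1..n} - {i}. \<phi> (W i \<omega>) (W j \<omega>))"

text \<open>\<open>kernel_proj M S \<phi> W j i\<close> is (a version of) the conditional expectation of
  \<open>\<phi> (W i) (W j)\<close> given \<open>W i\<close>, as a random variable on \<open>M\<close>.\<close>

definition kernel_proj ::
  "'w measure \<Rightarrow> 'a measure \<Rightarrow> ('a \<Rightarrow> 'a \<Rightarrow> real) \<Rightarrow> (nat \<Rightarrow> 'w \<Rightarrow> 'a) \<Rightarrow> nat \<Rightarrow> nat \<Rightarrow> 'w \<Rightarrow> real" where
  "kernel_proj M S \<phi> W j i =
     real_cond_exp M (vimage_algebra (space M) (W i) S) (\<lambda>\<omega>. \<phi> (W i \<omega>) (W j \<omega>))"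

text \<open>If the cluster of \<open>i\<close> is all of \<open>{1..n}\<close>, the averaged projection is undefined
  mathematically; here it is \<open>0\<close>.\<close>

definition avg_proj ::
  "'w measure \<Rightarrow> 'a measure \<Rightarrow> ('a \<Rightarrow> 'a \<Rightarrow> real) \<Rightarrow> (nat \<Rightarrow> 'w \<Rightarrow> 'a) \<Rightarrow> nat \<Rightarrow> (nat \<Rightarrow> nat)
     \<Rightarrow> nat \<Rightarrow> 'w \<Rightarrow> real" where
  "avg_proj M S \<phi> W n g i \<omega> =
     1 / (real n - real (cluster_size n g (g i))) *
       (\<Sum>j\<in>{1..n}. of_bool (j \<notin> cluster n g (g i)) * kernel_proj M S \<phi> W j i \<omega>)"

definition sigma_U ::
  "'w measure \<Rightarrow> 'a measure \<Rightarrow> ('a \<Rightarrow> 'a \<Rightarrow> real) \<Rightarrow> (nat \<Rightarrow> 'w \<Rightarrow> 'a) \<Rightarrow> nat \<Rightarrow> (nat \<Rightarrow> nat)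
     \<Rightarrow> nat \<Rightarrow> real" where
  "sigma_U M S \<phi> W n g G =
     sqrt (4 / real n *
       (\<Sum>k\<in>{1..G}. (LINT \<omega>|M. (\<Sum>i\<in>cluster n g k. avg_proj M S \<phi> W n g i \<omega>)\<^sup>2)))"

text \<open>Stochastic order symbols \<open>X\<^sub>n = O\<^sub>p(a\<^sub>n)\<close> and \<open>X\<^sub>n = o\<^sub>p(a\<^sub>n)\<close>, where \<open>X\<^sub>n\<close> lives on \<open>M\<^sub>n\<close>.\<close>

definition big_O_p :: "(nat \<Rightarrow> 'w measure) \<Rightarrow> (nat \<Rightarrow> 'w \<Rightarrow> real) \<Rightarrow> (nat \<Rightarrow> real) \<Rightarrow> bool" where
  "big_O_p M X a \<longleftrightarrow>
     (\<forall>\<epsilon>>0. \<exists>K>0. \<forall>\<^sub>F n in sequentially.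
        measure (M n) {\<omega> \<in> space (M n). \<bar>X n \<omega>\<bar> > K * a n} \<le> \<epsilon>)"

definition small_o_p :: "(nat \<Rightarrow> 'w measure) \<Rightarrow> (nat \<Rightarrow> 'w \<Rightarrow> real) \<Rightarrow> (nat \<Rightarrow> real) \<Rightarrow> bool" where
  "small_o_p M X a \<longleftrightarrow>
     (\<forall>\<epsilon>>0. (\<lambda>n. measure (M n) {\<omega> \<in> space (M n). \<bar>X n \<omega>\<bar> > \<epsilon> * a n}) \<longlonglongrightarrow> 0)"

end

theory Submission
  imports Defs
begin

text \<open>
  The kernel splits over cross-cluster pairs as
  \<open>\<phi>(W\<^sub>i, W\<^sub>j) = h\<^sub>j(W\<^sub>i) + h\<^sub>i(W\<^sub>j) + R\<^sub>i\<^sub>j\<close> (Hoeffding), where \<open>h\<^sub>j(x) = E \<phi>(x, W\<^sub>j)\<close>. The remainders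
  \<open>R\<^sub>i\<^sub>j\<close> and \<open>R\<^sub>k\<^sub>l\<close> are orthogonal unless they involve the same two clusters, so at most
  \<open>2 n\<^sup>2 m\<^sup>2\<close> products contribute to the second moment of their sum; together with the at most
  \<open>n m\<close> within-cluster terms this gives an \<open>L\<^sup>1\<close> error of order \<open>m / n\<close>. The linear part
  is a sum of independent cluster totals with second moment at most \<open>4 B m / n\<close>, where \<open>B\<close> bounds
  \<open>E \<phi>\<^sup>2\<close>. For the central limit theorem the Lindeberg condition is needed for the cluster totals:
  each total divided by its cluster size is an average of conditional expectations of kernel values, so
  Jensen's inequality for the convex function \<open>x \<mapsto> (\<bar>x\<bar> - K)\<^sub>+ powr r\<close> transfers the uniform
  integrability of \<open>\<bar>\<phi>\<bar> powr r\<close> to it.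
\<close>

section \<open>Moments, convexity and independence\<close>

text \<open>\<open>avg_proj\<close> is built from conditional expectations, which are determined
  only almost everywhere, whereas independence across clusters and integrating out one unit both
  call for genuine functions of the observations. The work is therefore done with the pointwise
  versions \<open>h\<close>, \<open>H\<close> and \<open>Y\<close>, linked to
  \<open>kernel_proj\<close> and \<open>avg_proj\<close> by almost-everywhere equality. The
  truncated power in the integrability hypothesis jumps at \<open>K\<close>, so it is not convex and
  is not preserved by averaging. The soft threshold is convex, lies below it, and controls it up to
  the factor \<open>2 powr r\<close> where \<open>\<bar>x\<bar> \<ge> 2 * K\<close>. With truncation
  at a level of order \<open>sqrt n\<close>, the bound on the sum of \<open>n\<^sub>g powr r\<close>
  makes the truncated second moments of the totals a small multiple of \<open>n\<close>. The
  condition on the largest cluster makes this level exceed \<open>2 * K * m\<close>, and makes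
  \<open>sqrt n\<close> times the error \<open>m / n\<close> vanish. All approximation errors are
  measured in L1: Markov's inequality then gives the stochastic orders, and the Lipschitz property
  of \<open>exp (i t x)\<close> carries the same error to characteristic functions, in place of a
  Slutsky argument.\<close>

lemma (in prob_space) indep_var_iterated_integral:
  fixes f :: "'b \<times> 'b \<Rightarrow> real"
  assumes ind: "indep_var S X T Y"
    and f[measurable]: "f \<in> borel_measurable (S \<Otimes>\<^sub>M T)"
    and int: "integrable M (\<lambda>\<omega>. f (X \<omega>, Y \<omega>))"
  shows "integrable M (\<lambda>\<omega>. \<integral>\<omega>'. f (X \<omega>, Y \<omega>') \<partial>M)"
    and "expectation (\<lambda>\<omega>. f (X \<omega>, Y \<omega>)) = expectation (\<lambda>\<omega>. \<integral>\<omega>'. f (X \<omega>, Y \<omega>') \<partial>M)"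
proof -
  have [measurable]: "X \<in> measurable M S" "Y \<in> measurable M T"
    using ind by (auto dest: indep_var_rv1 indep_var_rv2)
  \<comment> \<open>Independence enters here: the joint law is the product of the marginal laws, so
    Fubini applies. The inner integral is then pulled back to \<open>M\<close>, with a fresh sample
    point \<open>\<omega>'\<close>.\<close>
  have eq: "distr M S X \<Otimes>\<^sub>M distr M T Y = distr M (S \<Otimes>\<^sub>M T) (\<lambda>x. (X x, Y x))"
    using ind unfolding indep_var_distribution_eq by auto
  interpret X: prob_space "distr M S X" by (rule prob_space_distr) simp
  interpret Y: prob_space "distr M T Y" by (rule prob_space_distr) simp
  interpret P: pair_prob_space "distr M S X" "distr M T Y" ..
  have m: "(\<lambda>x. \<integral>\<omega>'. f (x, Y \<omega>') \<partial>M) \<in> borel_measurable S"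
    by measurable
  have i: "integrable (distr M S X \<Otimes>\<^sub>M distr M T Y) f"
    unfolding eq using int by (subst integrable_distr_eq) auto
  have inner: "(\<integral>y. f (x, y) \<partial>distr M T Y) = (\<integral>\<omega>'. f (x, Y \<omega>') \<partial>M)" if "x \<in> space S" for x
    using that by (intro integral_distr) auto
  have "integrable (distr M S X) (\<lambda>x. \<integral>y. f (x, y) \<partial>distr M T Y)"
    by (rule P.integrable_fst'[OF i])
  then have "integrable (distr M S X) (\<lambda>x. \<integral>\<omega>'. f (x, Y \<omega>') \<partial>M)"
    by (rule Bochner_Integration.integrable_cong[THEN iffD1, OF refl, rotated]) (simp add: inner)
  then show "integrable M (\<lambda>\<omega>. \<integral>\<omega>'. f (X \<omega>, Y \<omega>') \<partial>M)"
    using m by (subst (asm) integrable_distr_eq) auto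
  have "expectation (\<lambda>\<omega>. f (X \<omega>, Y \<omega>)) = (\<integral>z. f z \<partial>(distr M S X \<Otimes>\<^sub>M distr M T Y))"
    unfolding eq by (intro integral_distr[symmetric]) auto
  also have "\<dots> = (\<integral>x. \<integral>y. f (x, y) \<partial>distr M T Y \<partial>distr M S X)"
    by (rule P.integral_fst'[OF i, symmetric])
  also have "\<dots> = (\<integral>x. \<integral>\<omega>'. f (x, Y \<omega>') \<partial>M \<partial>distr M S X)"
    by (rule Bochner_Integration.integral_cong) (simp_all add: inner)
  also have "\<dots> = expectation (\<lambda>\<omega>. \<integral>\<omega>'. f (X \<omega>, Y \<omega>') \<partial>M)"
    using m by (intro integral_distr) auto
  finally show "expectation (\<lambda>\<omega>. f (X \<omega>, Y \<omega>)) = expectation (\<lambda>\<omega>. \<integral>\<omega>'. f (X \<omega>, Y \<omega>') \<partial>M)" .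
qed

text \<open>The variance of \<open>\<bar>X\<bar>\<close> is nonnegative.\<close>

lemma (in prob_space) expectation_abs_le_sqrt:
  fixes X :: "'a \<Rightarrow> real"
  assumes "X \<in> borel_measurable M" "integrable M (\<lambda>\<omega>. (X \<omega>)\<^sup>2)" "expectation (\<lambda>\<omega>. (X \<omega>)\<^sup>2) \<le> b"
  shows "expectation (\<lambda>\<omega>. \<bar>X \<omega>\<bar>) \<le> sqrt b"
proof -
  have [simp]: "integrable M X"
    using square_integrable_imp_integrable[OF assms(1,2)] .
  have "0 \<le> expectation (\<lambda>\<omega>. (\<bar>X \<omega>\<bar> - expectation (\<lambda>\<omega>. \<bar>X \<omega>\<bar>))\<^sup>2)"
    by simp
  also have "\<dots> = expectation (\<lambda>\<omega>. (X \<omega>)\<^sup>2) - (expectation (\<lambda>\<omega>. \<bar>X \<omega>\<bar>))\<^sup>2"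
    using assms by (subst variance_eq) auto
  finally have "(expectation (\<lambda>\<omega>. \<bar>X \<omega>\<bar>))\<^sup>2 \<le> b"
    using assms by simp
  then show ?thesis
    by (rule real_le_rsqrt)
qed

text \<open>Only the endpoint \<open>x = 0\<close> has to be added to \<open>powr_convex\<close>;
  there the claim reduces to \<open>t powr p \<le> t\<close> for \<open>t\<close> between 0 and
  1.\<close>

lemma convex_on_powr_nonneg:
  fixes p :: real
  assumes "p \<ge> 1"
  shows "convex_on {0..} (\<lambda>x. x powr p)"
proof (rule convex_on_linorderI)
  fix t x y :: real
  assume t: "0 < t" "t < 1" and xy: "x \<in> {0..}" "y \<in> {0..}" "x < y"
  show "((1 - t) *\<^sub>R x + t *\<^sub>R y) powr p \<le> (1 - t) * x powr p + t * y powr p"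
  proof (cases "x = 0")
    case True
    have "t powr p \<le> t powr 1"
      using t assms by (intro powr_mono') auto
    then show ?thesis
      using True t xy by (simp add: powr_mult mult_right_mono)
  next
    case False
    then show ?thesis
      using convex_onD[OF powr_convex[OF assms], of t x y] t xy by auto
  qed
qed auto

text \<open>A convex nondecreasing power on the half line is composed with the convex function
  \<open>max (\<bar>x\<bar> - K) 0\<close>.\<close>

lemma convex_on_soft_threshold_powr:
  fixes p K :: real
  assumes "p \<ge> 1"
  shows "convex_on UNIV (\<lambda>x. (max (\<bar>x\<bar> - K) 0) powr p)"
proof (rule convex_onI)
  fix t x y :: real
  assume t: "0 < t" "t < 1"
  have "\<bar>(1 - t) * x + t * y\<bar> \<le> (1 - t) * \<bar>x\<bar> + t * \<bar>y\<bar>"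
    using t abs_triangle_ineq[of "(1 - t) * x" "t * y"] unfolding abs_mult by simp
  then have "\<bar>(1 - t) *\<^sub>R x + t *\<^sub>R y\<bar> - K \<le> (1 - t) * (\<bar>x\<bar> - K) + t * (\<bar>y\<bar> - K)"
    by (simp add: right_diff_distrib left_diff_distrib)
  also have "\<dots> \<le> (1 - t) * max (\<bar>x\<bar> - K) 0 + t * max (\<bar>y\<bar> - K) 0"
    using t by (intro add_mono mult_left_mono) auto
  finally have "max (\<bar>(1 - t) *\<^sub>R x + t *\<^sub>R y\<bar> - K) 0 \<le> (1 - t) * max (\<bar>x\<bar> - K) 0 + t * max (\<bar>y\<bar> - K) 0"
    using t by (simp add: add_nonneg_nonneg)
  then have "max (\<bar>(1 - t) *\<^sub>R x + t *\<^sub>R y\<bar> - K) 0 powr p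
      \<le> ((1 - t) * max (\<bar>x\<bar> - K) 0 + t * max (\<bar>y\<bar> - K) 0) powr p"
    using assms by (intro powr_mono2) auto
  also have "\<dots> \<le> (1 - t) * max (\<bar>x\<bar> - K) 0 powr p + t * max (\<bar>y\<bar> - K) 0 powr p"
    using convex_onD[OF convex_on_powr_nonneg[OF assms], of t "max (\<bar>x\<bar> - K) 0" "max (\<bar>y\<bar> - K) 0"] t
    by simp
  finally show "max (\<bar>(1 - t) *\<^sub>R x + t *\<^sub>R y\<bar> - K) 0 powr p
      \<le> (1 - t) * max (\<bar>x\<bar> - K) 0 powr p + t * max (\<bar>y\<bar> - K) 0 powr p" .
qed simp

text \<open>Serves to replace the Taylor value \<open>1 - u\<close> of a characteristic function by
  the Gaussian factor \<open>exp (- u)\<close>. Up to \<open>u = 1\<close> the upper estimate comes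
  from \<open>exp (- u) \<le> 1 / (1 + u)\<close>; beyond, \<open>u\<^sup>2\<close> exceeds
  \<open>u\<close> and crude bounds suffice.\<close>

lemma one_minus_exp_neg_bound:
  fixes u :: real
  assumes "0 \<le> u"
  shows "\<bar>exp (- u) - (1 - u)\<bar> \<le> u\<^sup>2"
proof (cases "u \<le> 1")
  case True
  have a: "1 - u \<le> exp (- u)"
    using exp_ge_add_one_self[of "-u"] by simp
  have "exp (- u) * (1 + u) \<le> exp (-u) * exp u"
    using exp_ge_add_one_self[of "u"] by (intro mult_left_mono) auto
  then have "exp (- u) \<le> 1 / (1 + u)"
    using assms by (simp add: exp_minus field_simps)
  also have "1 / (1 + u) \<le> 1 - u + u\<^sup>2"
    using assms by (simp add: field_simps power2_eq_square)
  finally show ?thesis using a by simp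
next
  case False
  then have "u \<le> u\<^sup>2" by (simp add: power2_eq_square)
  moreover have "exp (-u) \<le> 1" "exp (-u) > 0" using assms by auto
  moreover have "1 - u \<le> exp (- u)"
    using exp_ge_add_one_self[of "-u"] by simp
  ultimately show ?thesis using False by linarith
qed

context finite_measure_subalgebra
begin

text \<open>Conditional Jensen inequality, integrated with the tower property.\<close>

lemma expectation_convex_cond_exp_le:
  fixes q :: "real \<Rightarrow> real"
  assumes X: "integrable M X" and q: "integrable M (\<lambda>\<omega>. q (X \<omega>))" "convex_on UNIV q" "q \<in> borel_measurable borel"
  shows "integrable M (\<lambda>\<omega>. q (real_cond_exp M F X \<omega>))"
    and "(\<integral>\<omega>. q (real_cond_exp M F X \<omega>) \<partial>M) \<le> (\<integral>\<omega>. q (X \<omega>) \<partial>M)"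
proof -
  show i: "integrable M (\<lambda>\<omega>. q (real_cond_exp M F X \<omega>))"
    by (rule integrable_convex_cond_exp[OF X _ _ q]) auto
  have "AE \<omega> in M. q (real_cond_exp M F X \<omega>) \<le> real_cond_exp M F (\<lambda>\<omega>. q (X \<omega>)) \<omega>"
    by (rule real_cond_exp_jensens_inequality(2)[OF X _ _ q]) auto
  then have "(\<integral>\<omega>. q (real_cond_exp M F X \<omega>) \<partial>M) \<le> (\<integral>\<omega>. real_cond_exp M F (\<lambda>\<omega>. q (X \<omega>)) \<omega> \<partial>M)"
    by (intro integral_mono_AE i real_cond_exp_int q)
  also have "\<dots> = (\<integral>\<omega>. q (X \<omega>) \<partial>M)"
    by (rule real_cond_exp_int(2)[OF q(1)])
  finally show "(\<integral>\<omega>. q (real_cond_exp M F X \<omega>) \<partial>M) \<le> (\<integral>\<omega>. q (X \<omega>) \<partial>M)" .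
qed

end

lemma finite_measure_subalgebra_vimage:
  assumes "finite_measure M" "X \<in> measurable M S"
  shows "finite_measure_subalgebra M (vimage_algebra (space M) X S)"
proof -
  interpret finite_measure M by fact
  have "X \<in> space M \<rightarrow> space S" using assms(2) by (auto dest: measurable_space)
  then have "subalgebra M (vimage_algebra (space M) X S)"
    using assms(2) by (auto simp: subalgebra_def sets_vimage_algebra2 intro: measurable_sets)
  then show ?thesis
    by unfold_locales
qed

lemma convex_mean_le:
  fixes q :: "real \<Rightarrow> real"
  assumes "convex_on UNIV q" "finite I" "I \<noteq> {}"
  shows "q ((\<Sum>i\<in>I. f i) / real (card I)) \<le> (\<Sum>i\<in>I. q (f i)) / real (card I)"
  using convex_on_sum[OF assms(2,3,1), of "\<lambda>_. 1 / real (card I)" f] assms(2,3)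
  by (simp add: sum_divide_distrib)

text \<open>Jensen for a uniform average. It serves both averages that occur later: over the units
  outside the cluster of a given unit, and over the units of one cluster.\<close>

lemma (in prob_space) expectation_convex_mean_le:
  fixes q :: "real \<Rightarrow> real"
  assumes q: "convex_on UNIV q" "q \<in> borel_measurable borel" "\<And>x. 0 \<le> q x"
    and I: "finite I" "I \<noteq> {}"
    and meas: "\<And>i. i \<in> I \<Longrightarrow> f i \<in> borel_measurable M"
    and int: "\<And>i. i \<in> I \<Longrightarrow> integrable M (\<lambda>\<omega>. q (f i \<omega>))"
    and le: "\<And>i. i \<in> I \<Longrightarrow> expectation (\<lambda>\<omega>. q (f i \<omega>)) \<le> b"
  shows "integrable M (\<lambda>\<omega>. q ((\<Sum>i\<in>I. f i \<omega>) / real (card I)))"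
    and "expectation (\<lambda>\<omega>. q ((\<Sum>i\<in>I. f i \<omega>) / real (card I))) \<le> b"
proof -
  have bound: "q ((\<Sum>i\<in>I. f i \<omega>) / real (card I)) \<le> (\<Sum>i\<in>I. q (f i \<omega>)) / real (card I)" for \<omega>
    by (rule convex_mean_le[OF q(1) I])
  have int': "integrable M (\<lambda>\<omega>. (\<Sum>i\<in>I. q (f i \<omega>)) / real (card I))"
    using int by auto
  have m: "(\<lambda>\<omega>. q ((\<Sum>i\<in>I. f i \<omega>) / real (card I))) \<in> borel_measurable M"
    using q(2) meas by (intro measurable_compose[OF _ q(2)] borel_measurable_divide borel_measurable_sum) auto
  show i: "integrable M (\<lambda>\<omega>. q ((\<Sum>i\<in>I. f i \<omega>) / real (card I)))"
    by (rule Bochner_Integration.integrable_bound[OF int' m])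
      (use bound q(3) in \<open>auto simp: sum_nonneg\<close>)
  have "expectation (\<lambda>\<omega>. q ((\<Sum>i\<in>I. f i \<omega>) / real (card I)))
      \<le> expectation (\<lambda>\<omega>. (\<Sum>i\<in>I. q (f i \<omega>)) / real (card I))"
    by (rule integral_mono[OF i int' bound])
  also have "\<dots> = (\<Sum>i\<in>I. expectation (\<lambda>\<omega>. q (f i \<omega>))) / real (card I)"
    using int by simp
  also have "\<dots> \<le> (real (card I) * b) / real (card I)"
    using le by (intro divide_right_mono sum_bounded_above) auto
  also have "\<dots> = b" using I by simp
  finally show "expectation (\<lambda>\<omega>. q ((\<Sum>i\<in>I. f i \<omega>) / real (card I))) \<le> b" .
qed

lemma (in prob_space) prob_abs_gt_le:
  fixes X :: "'a \<Rightarrow> real"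
  assumes X: "integrable M X" and u: "u > 0"
  shows "prob {\<omega> \<in> space M. \<bar>X \<omega>\<bar> > u} \<le> expectation (\<lambda>\<omega>. \<bar>X \<omega>\<bar>) / u"
proof -
  have [measurable]: "X \<in> borel_measurable M" using X by simp
  have "prob {\<omega> \<in> space M. \<bar>X \<omega>\<bar> > u} \<le> prob {\<omega> \<in> space M. \<bar>X \<omega>\<bar> \<ge> u}"
    by (intro finite_measure_mono) auto
  also have "\<dots> \<le> expectation (\<lambda>\<omega>. \<bar>X \<omega>\<bar>) / u"
    by (rule integral_Markov_inequality_measure[where A = "{}"]) (use X u in auto)
  finally show ?thesis .
qed

lemma big_O_p_expectation:
  assumes c: "c \<ge> 0"
    and bound: "\<forall>\<^sub>F n in sequentially. prob_space (M n) \<and> integrable (M n) (X n) \<and> a n > 0 \<and>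
      (\<integral>\<omega>. \<bar>X n \<omega>\<bar> \<partial>M n) \<le> c * a n"
  shows "big_O_p M X a"
  unfolding big_O_p_def
proof (intro allI impI)
  fix \<epsilon> :: real assume \<epsilon>: "\<epsilon> > 0"
  \<comment> \<open>Markov gives probability at most \<open>c / K\<close>; the added 1 keeps
    \<open>K\<close> positive when \<open>c = 0\<close>.\<close>
  define K where "K = (c + 1) / \<epsilon>"
  have K: "K > 0" using c \<epsilon> by (simp add: K_def)
  have "\<forall>\<^sub>F n in sequentially. measure (M n) {\<omega> \<in> space (M n). \<bar>X n \<omega>\<bar> > K * a n} \<le> \<epsilon>"
    using bound
  proof eventually_elim
    case (elim n)
    then interpret prob_space "M n" by simp
    have a: "a n > 0" using elim by simp
    have "prob {\<omega> \<in> space (M n). \<bar>X n \<omega>\<bar> > K * a n} \<le> expectation (\<lambda>\<omega>. \<bar>X n \<omega>\<bar>) / (K * a n)"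
      using elim K by (intro prob_abs_gt_le) auto
    also have "\<dots> \<le> c * a n / (K * a n)"
      using elim K by (intro divide_right_mono) auto
    also have "\<dots> = c / K" using a by simp
    also have "\<dots> = \<epsilon> * (c / (c + 1))" using c by (simp add: K_def)
    also have "\<dots> \<le> \<epsilon>" using \<epsilon> c by (intro mult_left_le) auto
    finally show ?case .
  qed
  then show "\<exists>K>0. \<forall>\<^sub>F n in sequentially. measure (M n) {\<omega> \<in> space (M n). \<bar>X n \<omega>\<bar> > K * a n} \<le> \<epsilon>"
    using K by blast
qed

lemma small_o_p_expectation:
  assumes bound: "\<forall>\<^sub>F n in sequentially. prob_space (M n) \<and> integrable (M n) (X n) \<and>
      (\<integral>\<omega>. \<bar>X n \<omega>\<bar> \<partial>M n) \<le> b n"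
    and b: "b \<longlonglongrightarrow> 0"
  shows "small_o_p M X (\<lambda>_. 1)"
  unfolding small_o_p_def
proof (intro allI impI)
  fix \<epsilon> :: real assume \<epsilon>: "\<epsilon> > 0"
  have "\<forall>\<^sub>F n in sequentially. norm (measure (M n) {\<omega> \<in> space (M n). \<bar>X n \<omega>\<bar> > \<epsilon> * 1}) \<le> b n / \<epsilon>"
    using bound
  proof eventually_elim
    case (elim n)
    then interpret prob_space "M n" by simp
    have "prob {\<omega> \<in> space (M n). \<bar>X n \<omega>\<bar> > \<epsilon>} \<le> expectation (\<lambda>\<omega>. \<bar>X n \<omega>\<bar>) / \<epsilon>"
      using elim \<epsilon> by (intro prob_abs_gt_le) auto
    also have "\<dots> \<le> b n / \<epsilon>"
      using elim \<epsilon> by (intro divide_right_mono) auto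
    finally show ?case by simp
  qed
  moreover have "(\<lambda>n. b n / \<epsilon>) \<longlonglongrightarrow> 0"
    using tendsto_divide[OF b tendsto_const[of \<epsilon>]] \<epsilon> by simp
  ultimately show "(\<lambda>n. measure (M n) {\<omega> \<in> space (M n). \<bar>X n \<omega>\<bar> > \<epsilon> * 1}) \<longlonglongrightarrow> 0"
    by (rule Lim_null_comparison)
qed

text \<open>Needed because nothing is assumed about the measure at index 0, while Levy continuity
  asks every member of the sequence to be a distribution.\<close>

lemma weak_conv_m_from_Suc:
  assumes "weak_conv_m (\<lambda>n. \<mu> (Suc n)) \<nu>"
  shows "weak_conv_m \<mu> \<nu>"
  using assms unfolding weak_conv_m_def weak_conv_def
  by (simp add: filterlim_sequentially_Suc[where f = "\<lambda>n. cdf (\<mu> n) x" for x])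

text \<open>The uniform integrability hypothesis speaks of nonnegative integrals and does not
  presuppose integrability; a finite bound supplies it.\<close>

lemma integrable_expectation_le_if_nn_integral_le:
  fixes f :: "'a \<Rightarrow> real"
  assumes "f \<in> borel_measurable M" "\<And>x. 0 \<le> f x" "(\<integral>\<^sup>+x. ennreal (f x) \<partial>M) \<le> ennreal b" "0 \<le> b"
  shows "integrable M f" "(\<integral>x. f x \<partial>M) \<le> b"
proof -
  show i: "integrable M f"
    using assms by (intro integrableI_nonneg) (auto intro: le_less_trans)
  show "(\<integral>x. f x \<partial>M) \<le> b"
    using assms nn_integral_eq_integral[OF i] by simp
qed

section \<open>Characteristic functions\<close>

text \<open>Lindeberg's theorem in quantitative form. The error depends on \<open>t\<close>,
  \<open>\<epsilon>\<close> and \<open>L\<close> alone, so the bound applies along a triangular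
  array whose rows live on different probability spaces.\<close>

lemma (in prob_space) lindeberg_char_bound:
  fixes X :: "'i \<Rightarrow> 'a \<Rightarrow> real"
  assumes I: "finite I" and ind: "indep_vars (\<lambda>_. borel) X I"
    and sq: "\<And>k. k \<in> I \<Longrightarrow> integrable M (\<lambda>\<omega>. (X k \<omega>)\<^sup>2)"
    and mean: "\<And>k. k \<in> I \<Longrightarrow> expectation (X k) = 0"
    and var: "(\<Sum>k\<in>I. expectation (\<lambda>\<omega>. (X k \<omega>)\<^sup>2)) = 1"
    and \<epsilon>: "\<epsilon> > 0"
    and L: "(\<Sum>k\<in>I. expectation (\<lambda>\<omega>. (X k \<omega>)\<^sup>2 * of_bool (\<bar>X k \<omega>\<bar> > \<epsilon>))) \<le> L"
  shows "cmod (char (distr M borel (\<lambda>\<omega>. \<Sum>k\<in>I. X k \<omega>)) t - exp (- (t\<^sup>2) / 2))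
    \<le> \<bar>t\<bar> ^ 3 * \<epsilon> / 6 + t\<^sup>2 * L + t ^ 4 / 4 * (\<epsilon>\<^sup>2 + L)"
proof -
  have rv[measurable]: "X k \<in> borel_measurable M" if "k \<in> I" for k
    using ind that unfolding indep_vars_def by auto
  have int[simp]: "integrable M (X k)" if "k \<in> I" for k
    using square_integrable_imp_integrable[OF rv[OF that] sq[OF that]] .
  define s where "s k = expectation (\<lambda>\<omega>. (X k \<omega>)\<^sup>2)" for k
  define l where "l k = expectation (\<lambda>\<omega>. (X k \<omega>)\<^sup>2 * of_bool (\<bar>X k \<omega>\<bar> > \<epsilon>))" for k
  have s0: "0 \<le> s k" for k unfolding s_def by simp
  have l0: "0 \<le> l k" for k unfolding l_def by simp
  have l_int: "integrable M (\<lambda>\<omega>. (X k \<omega>)\<^sup>2 * of_bool (\<bar>X k \<omega>\<bar> > \<epsilon>))" if "k \<in> I" for k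
    using that by (intro Bochner_Integration.integrable_bound[OF sq[OF that]]) auto
  have L0: "0 \<le> L" using L l0 unfolding l_def[symmetric] by (meson order_trans sum_nonneg)
  \<comment> \<open>Every single variance is small: the part of \<open>X k\<close> below
    \<open>\<epsilon>\<close> contributes at most \<open>\<epsilon>\<^sup>2\<close>, the rest at
    most the whole Lindeberg sum.\<close>
  have s_le: "s k \<le> \<epsilon>\<^sup>2 + L" if k: "k \<in> I" for k
  proof -
    have "s k \<le> expectation (\<lambda>\<omega>. \<epsilon>\<^sup>2 + (X k \<omega>)\<^sup>2 * of_bool (\<bar>X k \<omega>\<bar> > \<epsilon>))"
      unfolding s_def using k
    proof (intro integral_mono sq Bochner_Integration.integrable_add l_int)
      fix \<omega>
      show "(X k \<omega>)\<^sup>2 \<le> \<epsilon>\<^sup>2 + (X k \<omega>)\<^sup>2 * of_bool (\<bar>X k \<omega>\<bar> > \<epsilon>)"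
        using \<epsilon> by (auto simp: not_less abs_le_square_iff[symmetric])
    qed auto
    also have "\<dots> = \<epsilon>\<^sup>2 + l k"
      using l_int[OF k] by (simp add: l_def prob_space)
    also have "l k \<le> (\<Sum>k\<in>I. l k)"
      using I k l0 by (intro member_le_sum) auto
    finally show ?thesis using L by (simp add: l_def)
  qed
  \<comment> \<open>Each factor passes from the characteristic function \<open>c k\<close> through
    its second-order Taylor value \<open>w k\<close> to the Gaussian factor \<open>e k\<close> of
    equal variance. The first step costs a Lindeberg term, the second a squared variance, of which
    \<open>s_le\<close> bounds one factor.\<close>
  define w where "w k = (1 - t\<^sup>2 * s k / 2)" for k
  define e where "e k = exp (- (t\<^sup>2 * s k / 2))" for k
  define c where "c k = char (distr M borel (X k)) t" for k
  have c1: "cmod (c k - w k) \<le> t\<^sup>2 / 6 * (\<bar>t\<bar> * \<epsilon> * s k) + t\<^sup>2 * l k" if k: "k \<in> I" for k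
  proof -
    have "cmod (c k - (1 - t^2 * s k / 2)) \<le>
        (t^2 / 6) * expectation (\<lambda>\<omega>. min (6 * (X k \<omega>)\<^sup>2) (\<bar>t\<bar> * \<bar>X k \<omega>\<bar>^3))"
      unfolding c_def
    proof (rule char_approx3'[OF _ _ _ _ _ refl])
      show "variance (X k) = s k"
        unfolding s_def mean[OF k] by simp
    qed (use k in \<open>auto intro: sq mean\<close>)
    also have "expectation (\<lambda>\<omega>. min (6 * (X k \<omega>)\<^sup>2) (\<bar>t\<bar> * \<bar>X k \<omega>\<bar>^3))
      \<le> expectation (\<lambda>\<omega>. (\<bar>t\<bar> * \<epsilon>) * (X k \<omega>)\<^sup>2 + 6 * ((X k \<omega>)\<^sup>2 * of_bool (\<bar>X k \<omega>\<bar> > \<epsilon>)))"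
    proof (rule integral_mono)
      show "integrable M (\<lambda>\<omega>. min (6 * (X k \<omega>)\<^sup>2) (\<bar>t\<bar> * \<bar>X k \<omega>\<bar>^3))"
        by (rule Bochner_Integration.integrable_bound[where f = "\<lambda>\<omega>. 6 * (X k \<omega>)\<^sup>2"])
          (use k sq[OF k] in auto)
      show "integrable M (\<lambda>\<omega>. (\<bar>t\<bar> * \<epsilon>) * (X k \<omega>)\<^sup>2 + 6 * ((X k \<omega>)\<^sup>2 * of_bool (\<bar>X k \<omega>\<bar> > \<epsilon>)))"
        using k sq[OF k] l_int[OF k] by auto
      fix \<omega>
      show "min (6 * (X k \<omega>)\<^sup>2) (\<bar>t\<bar> * \<bar>X k \<omega>\<bar>^3)
          \<le> (\<bar>t\<bar> * \<epsilon>) * (X k \<omega>)\<^sup>2 + 6 * ((X k \<omega>)\<^sup>2 * of_bool (\<bar>X k \<omega>\<bar> > \<epsilon>))"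
      \<comment> \<open>Large values use the quadratic branch of the minimum, small values the cubic
        one with a factor \<open>\<bar>X k \<omega>\<bar>\<close> replaced by
        \<open>\<epsilon>\<close>.\<close>
      proof (cases "\<bar>X k \<omega>\<bar> > \<epsilon>")
        case True
        then show ?thesis using \<epsilon> by (intro min.coboundedI1) simp
      next
        case False
        have "\<bar>X k \<omega>\<bar>^3 = \<bar>X k \<omega>\<bar> * (X k \<omega>)\<^sup>2"
          by (simp add: power3_eq_cube power2_eq_square)
        also have "\<dots> \<le> \<epsilon> * (X k \<omega>)\<^sup>2"
          using False by (intro mult_right_mono) auto
        finally have "\<bar>t\<bar> * \<bar>X k \<omega>\<bar>^3 \<le> \<bar>t\<bar> * (\<epsilon> * (X k \<omega>)\<^sup>2)"
          by (intro mult_left_mono) auto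
        then show ?thesis using False by (intro min.coboundedI2) (simp add: mult.assoc)
      qed
    qed
    also have "\<dots> = (\<bar>t\<bar> * \<epsilon>) * s k + 6 * l k"
      using k sq[OF k] l_int[OF k] by (simp add: s_def l_def)
    finally have "cmod (c k - w k) \<le> (t^2 / 6) * ((\<bar>t\<bar> * \<epsilon>) * s k + 6 * l k)"
      by (simp add: w_def mult_left_mono)
    then show ?thesis
      by (simp add: algebra_simps)
  qed
  have c2: "cmod (w k - e k) \<le> t ^ 4 / 4 * (\<epsilon>\<^sup>2 + L) * s k" if k: "k \<in> I" for k
  proof -
    have "cmod (complex_of_real (w k) - complex_of_real (e k)) = \<bar>e k - w k\<bar>"
      by (simp flip: of_real_diff add: abs_minus_commute)
    also have "\<dots> \<le> (t\<^sup>2 * s k / 2)\<^sup>2"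
      unfolding w_def e_def using s0[of k] by (intro one_minus_exp_neg_bound) simp
    also have "\<dots> = t ^ 4 / 4 * s k * s k"
      by (simp add: power2_eq_square eval_nat_numeral)
    also have "\<dots> \<le> t ^ 4 / 4 * (\<epsilon>\<^sup>2 + L) * s k"
      using s_le[OF k] s0[of k] by (intro mult_right_mono mult_left_mono) auto
    finally show ?thesis by simp
  qed
  have sum_s: "(\<Sum>k\<in>I. s k) = 1" using var by (simp add: s_def)
  have char_eq: "char (distr M borel (\<lambda>\<omega>. \<Sum>k\<in>I. X k \<omega>)) t = (\<Prod>k\<in>I. c k)"
    unfolding c_def by (rule char_distr_sum[OF ind])
  have "(\<Prod>k\<in>I. e k) = exp (- (t\<^sup>2) / 2)"
    unfolding e_def using I sum_s
    by (simp flip: exp_sum add: sum_negf sum_divide_distrib[symmetric] sum_distrib_left[symmetric])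
  then have exp_eq: "complex_of_real (exp (- (t\<^sup>2) / 2)) = (\<Prod>k\<in>I. complex_of_real (e k))"
    by (simp flip: of_real_prod)
  \<comment> \<open>All factors have modulus at most 1, so the products differ by at most the sum of
    the factorwise differences.\<close>
  have "cmod ((\<Prod>k\<in>I. c k) - (\<Prod>k\<in>I. complex_of_real (e k))) \<le> (\<Sum>k\<in>I. cmod (c k - e k))"
  proof (rule norm_prod_diff)
    fix k assume k: "k \<in> I"
    interpret D: real_distribution "distr M borel (X k)" using k by simp
    show "cmod (c k) \<le> 1" unfolding c_def by (rule D.cmod_char_le_1)
    show "cmod (complex_of_real (e k)) \<le> 1" unfolding e_def using s0[of k] by simp
  qed
  also have "\<dots> \<le> (\<Sum>k\<in>I. \<bar>t\<bar> ^ 3 * \<epsilon> / 6 * s k + t\<^sup>2 * l k + t ^ 4 / 4 * (\<epsilon>\<^sup>2 + L) * s k)"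
  proof (rule sum_mono)
    fix k assume k: "k \<in> I"
    have "cmod (c k - e k) \<le> cmod (c k - w k) + cmod (w k - e k)"
      using norm_triangle_ineq[of "c k - w k" "w k - e k"] by simp
    also have "\<dots> \<le> t\<^sup>2 / 6 * (\<bar>t\<bar> * \<epsilon> * s k) + t\<^sup>2 * l k + t ^ 4 / 4 * (\<epsilon>\<^sup>2 + L) * s k"
      using c1[OF k] c2[OF k] by simp
    also have "t\<^sup>2 / 6 * (\<bar>t\<bar> * \<epsilon> * s k) = \<bar>t\<bar> ^ 3 * \<epsilon> / 6 * s k"
      by (simp add: power3_eq_cube power2_eq_square)
    finally show "cmod (c k - e k) \<le> \<bar>t\<bar> ^ 3 * \<epsilon> / 6 * s k + t\<^sup>2 * l k + t ^ 4 / 4 * (\<epsilon>\<^sup>2 + L) * s k" .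
  qed
  also have "\<dots> = \<bar>t\<bar> ^ 3 * \<epsilon> / 6 + t\<^sup>2 * (\<Sum>k\<in>I. l k) + t ^ 4 / 4 * (\<epsilon>\<^sup>2 + L)"
    unfolding sum.distrib sum_distrib_left[symmetric] sum_s by simp
  also have "\<dots> \<le> \<bar>t\<bar> ^ 3 * \<epsilon> / 6 + t\<^sup>2 * L + t ^ 4 / 4 * (\<epsilon>\<^sup>2 + L)"
    using L by (simp add: l_def mult_left_mono)
  finally show ?thesis unfolding char_eq exp_eq .
qed

text \<open>The function \<open>x \<mapsto> exp (i t x)\<close> is Lipschitz with constant
  \<open>\<bar>t\<bar>\<close>.\<close>

lemma (in prob_space) char_distr_diff_le:
  assumes [measurable]: "X \<in> borel_measurable M" "Y \<in> borel_measurable M"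
    and int: "integrable M (\<lambda>\<omega>. X \<omega> - Y \<omega>)"
  shows "cmod (char (distr M borel X) t - char (distr M borel Y) t)
    \<le> \<bar>t\<bar> * expectation (\<lambda>\<omega>. \<bar>X \<omega> - Y \<omega>\<bar>)"
proof -
  have le: "cmod (iexp (t * x) - iexp (t * y)) \<le> \<bar>t\<bar> * \<bar>x - y\<bar>" for x y :: real
  proof -
    have "iexp (t * x) - iexp (t * y) = iexp (t * y) * (iexp (t * (x - y)) - 1)"
      by (simp add: algebra_simps flip: exp_add)
    then have "cmod (iexp (t * x) - iexp (t * y)) = cmod (iexp (t * (x - y)) - 1)"
      by (simp add: norm_mult)
    also have "\<dots> \<le> \<bar>t * (x - y)\<bar>"
      using iexp_approx1[of "t * (x - y)" 0] by simp
    finally show ?thesis by (simp add: abs_mult)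
  qed
  have i: "integrable M (\<lambda>\<omega>. iexp (t * Z \<omega>))" if "Z \<in> borel_measurable M" for Z
    using that by (intro integrable_const_bound[where B = 1]) auto
  have char_eq: "char (distr M borel Z) t = expectation (\<lambda>\<omega>. iexp (t * Z \<omega>))"
    if "Z \<in> borel_measurable M" for Z
    unfolding char_def using that by (intro integral_distr) auto
  have "char (distr M borel X) t - char (distr M borel Y) t
      = expectation (\<lambda>\<omega>. iexp (t * X \<omega>) - iexp (t * Y \<omega>))"
    unfolding char_eq[OF assms(1)] char_eq[OF assms(2)]
    by (rule Bochner_Integration.integral_diff[symmetric]) (intro i assms)+
  also have "cmod \<dots> \<le> expectation (\<lambda>\<omega>. cmod (iexp (t * X \<omega>) - iexp (t * Y \<omega>)))"
    by (rule integral_norm_bound)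
  also have "\<dots> \<le> expectation (\<lambda>\<omega>. \<bar>t\<bar> * \<bar>X \<omega> - Y \<omega>\<bar>)"
  proof (rule integral_mono)
    show "integrable M (\<lambda>\<omega>. cmod (iexp (t * X \<omega>) - iexp (t * Y \<omega>)))"
      by (intro integrable_norm Bochner_Integration.integrable_diff i assms)
    show "integrable M (\<lambda>\<omega>. \<bar>t\<bar> * \<bar>X \<omega> - Y \<omega>\<bar>)"
      using int by simp
  qed (rule le)
  finally show ?thesis by simp
qed

section \<open>The Hoeffding decomposition of a clustered sample\<close>

text \<open>One sample size is fixed and all estimates are non-asymptotic with explicit constants.
  The limit statements then follow from a single second-moment bound \<open>B\<close> valid for
  every sample size.\<close>

locale clustered_sample = prob_space M
  for M :: "'w measure" +
  fixes S :: "'a measure" and \<phi> :: "'a \<Rightarrow> 'a \<Rightarrow> real" and W :: "nat \<Rightarrow> 'w \<Rightarrow> 'a"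
    and n :: nat and g :: "nat \<Rightarrow> nat" and G :: nat
  assumes n_ge_1: "n \<ge> 1"
    and W_measurable: "\<And>i. i \<in> {1..n} \<Longrightarrow> W i \<in> measurable M S"
    and g_image: "g ` {1..n} = {1..G}"
    and kernel_measurable: "(\<lambda>(x, y). \<phi> x y) \<in> borel_measurable (S \<Otimes>\<^sub>M S)"
    and kernel_symmetric: "\<And>x y. x \<in> space S \<Longrightarrow> y \<in> space S \<Longrightarrow> \<phi> x y = \<phi> y x"
    and kernel_centred: "\<And>i j. i \<in> {1..n} \<Longrightarrow> j \<in> {1..n} \<Longrightarrow> g i \<noteq> g j \<Longrightarrow>
          has_bochner_integral M (\<lambda>\<omega>. \<phi> (W i \<omega>) (W j \<omega>)) 0"
    and indep_clusters: "indep_across_clusters M S W n g G"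
    and kernel_square_integrable: "\<And>i j. i \<in> {1..n} \<Longrightarrow> j \<in> {1..n} \<Longrightarrow>
          integrable M (\<lambda>\<omega>. (\<phi> (W i \<omega>) (W j \<omega>))\<^sup>2)"
begin

abbreviation size :: "nat \<Rightarrow> nat" where
  "size k \<equiv> cluster_size n g k"

abbreviation m :: nat where
  "m \<equiv> max_cluster_size n g G"

abbreviation proj :: "nat \<Rightarrow> 'w \<Rightarrow> real" where
  "proj i \<equiv> avg_proj M S \<phi> W n g i"

definition others :: "nat \<Rightarrow> nat set" where
  "others i = {j \<in> {1..n}. g j \<noteq> g i}"

text \<open>\<open>h j (W i)\<close> is a version of the paper's \<open>\<phi>\<^sup>(\<^sup>1\<^sup>)\<^sub>j(W\<^sub>i)\<close> when \<open>j \<in> others i\<close>; unlike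
  \<open>kernel_proj\<close> it is given pointwise, as a function on \<open>S\<close>.\<close>

definition h :: "nat \<Rightarrow> 'a \<Rightarrow> real" where
  "h j x = (\<integral>\<omega>. \<phi> x (W j \<omega>) \<partial>M)"

text \<open>The degenerate part of the Hoeffding decomposition. No mean is added back, since the
  kernel is centred on the cross-cluster pairs for which this is used.\<close>

definition remainder :: "nat \<Rightarrow> nat \<Rightarrow> 'w \<Rightarrow> real" where
  "remainder i j \<omega> = \<phi> (W i \<omega>) (W j \<omega>) - h j (W i \<omega>) - h i (W j \<omega>)"

lemma kernel_compose_measurable[measurable (raw)]:
  assumes "f \<in> measurable N S" "f' \<in> measurable N S"
  shows "(\<lambda>x. \<phi> (f x) (f' x)) \<in> borel_measurable N"
  using measurable_compose[OF measurable_Pair[OF assms] kernel_measurable] by simp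

lemma h_measurable:
  assumes "j \<in> {1..n}"
  shows "h j \<in> borel_measurable S"
  using W_measurable[OF assms] unfolding h_def[abs_def] by measurable

lemma h_W_measurable:
  assumes "i \<in> {1..n}" "j \<in> {1..n}"
  shows "(\<lambda>\<omega>. h j (W i \<omega>)) \<in> borel_measurable M"
  by (rule measurable_compose[OF W_measurable[OF assms(1)] h_measurable[OF assms(2)]])

lemma kernel_W_measurable:
  assumes "i \<in> {1..n}" "j \<in> {1..n}"
  shows "(\<lambda>\<omega>. \<phi> (W i \<omega>) (W j \<omega>)) \<in> borel_measurable M"
  using W_measurable[OF assms(1)] W_measurable[OF assms(2)] by measurable

lemma size_le_max: "i \<in> {1..n} \<Longrightarrow> size (g i) \<le> m"
  using g_image unfolding max_cluster_size_def by (intro Max_ge) auto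

lemma size_le_max': "k \<in> {1..G} \<Longrightarrow> size k \<le> m"
  unfolding max_cluster_size_def by (intro Max_ge) auto

lemma G_ge_1: "1 \<le> G"
  using g_image n_ge_1 by (cases G) auto

lemma finite_cluster[simp]: "finite (cluster n g k)"
  by (simp add: cluster_def)

lemma max_in_range: obtains k where "k \<in> {1..G}" "m = size k"
proof -
  have "m \<in> (\<lambda>k. size k) ` {1..G}"
    unfolding max_cluster_size_def using G_ge_1 by (intro Max_in) auto
  then show ?thesis using that by auto
qed

lemma cluster_nonempty:
  assumes "k \<in> {1..G}"
  shows "cluster n g k \<noteq> {}"
proof -
  obtain i where "i \<in> {1..n}" "k = g i"
    using assms unfolding g_image[symmetric] by (rule imageE)
  then have "i \<in> cluster n g k"
    by (simp add: cluster_def)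
  then show ?thesis by blast
qed

lemma size_pos: "k \<in> {1..G} \<Longrightarrow> 1 \<le> size k"
  using cluster_nonempty by (simp add: cluster_size_def Suc_le_eq card_gt_0_iff)

lemma size_le_n: "size k \<le> n"
  unfolding cluster_size_def cluster_def by (rule order_trans[OF card_mono[of "{1..n}"]]) auto

lemma m_le_n: "m \<le> n"
  by (rule max_in_range) (simp add: size_le_n)

lemma m_ge_1: "1 \<le> m"
  by (rule max_in_range) (use size_pos in auto)

lemma sum_by_cluster: "(\<Sum>k\<in>{1..G}. \<Sum>i\<in>cluster n g k. f i) = (\<Sum>i\<in>{1..n}. f i)" for f :: "nat \<Rightarrow> real"
  unfolding cluster_def using g_image by (intro sum.group) auto

lemma card_others: "real (card (others i)) = real n - real (size (g i))"
proof -
  have "others i = {1..n} - cluster n g (g i)"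
    by (auto simp: others_def cluster_def)
  then have "card (others i) = n - size (g i)"
    by (simp add: card_Diff_subset cluster_size_def cluster_def subset_eq)
  then show ?thesis using size_le_n by simp
qed

lemma proj_eq: "proj i \<omega> = (\<Sum>j\<in>others i. kernel_proj M S \<phi> W j i \<omega>) / real (card (others i))"
proof -
  have "(\<Sum>j\<in>{1..n}. of_bool (j \<notin> cluster n g (g i)) * kernel_proj M S \<phi> W j i \<omega>)
      = (\<Sum>j\<in>others i. kernel_proj M S \<phi> W j i \<omega>)"
    by (intro sum.mono_neutral_cong_right) (auto simp: others_def cluster_def)
  then show ?thesis
    by (simp add: avg_proj_def card_others)
qed

section \<open>Independence and integrating out a single unit\<close>

text \<open>\<open>indep_var\<close> needs both variables to have the same type, hence the one-element family
  for \<open>W i\<close>.\<close>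

lemma indep_others:
  assumes i: "i \<in> {1..n}"
  shows "indep_var (PiM (others i) (\<lambda>_. S)) (\<lambda>\<omega>. \<lambda>j\<in>others i. W j \<omega>)
    (PiM {i} (\<lambda>_. S)) (\<lambda>\<omega>. \<lambda>j\<in>{i}. W j \<omega>)"
proof -
  let ?P = "\<lambda>k. PiM (cluster n g k) (\<lambda>_. S)" and ?X = "\<lambda>k \<omega>. \<lambda>j\<in>cluster n g k. W j \<omega>"
  let ?A = "{1..G} - {g i}" and ?B = "{g i}"
  have gi: "g j \<in> {1..G}" if "j \<in> {1..n}" for j using g_image that by auto
  have "indep_var (PiM ?A ?P) (\<lambda>\<omega>. restrict (\<lambda>k. ?X k \<omega>) ?A) (PiM ?B ?P) (\<lambda>\<omega>. restrict (\<lambda>k. ?X k \<omega>) ?B)"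
    using indep_clusters gi[OF i] unfolding indep_across_clusters_def
    by (intro indep_var_restrict) auto
  \<comment> \<open>\<open>x (g j) j\<close> reads unit \<open>j\<close> from the block of its own
    cluster, which turns a family of cluster blocks into a family of units.\<close>
  then have "indep_var (PiM (others i) (\<lambda>_. S)) ((\<lambda>x. \<lambda>j\<in>others i. x (g j) j) \<circ> (\<lambda>\<omega>. restrict (\<lambda>k. ?X k \<omega>) ?A))
     (PiM {i} (\<lambda>_. S)) ((\<lambda>x. \<lambda>j\<in>{i}. x (g j) j) \<circ> (\<lambda>\<omega>. restrict (\<lambda>k. ?X k \<omega>) ?B))"
  proof (rule indep_var_compose)
    have *: "(\<lambda>x. x (g j) j) \<in> measurable (PiM J ?P) S" if "g j \<in> J" "j \<in> {1..n}" for j J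
      by (rule measurable_compose[OF measurable_component_singleton[OF that(1)]],
          rule measurable_component_singleton) (use that in \<open>simp add: cluster_def\<close>)
    show "(\<lambda>x. \<lambda>j\<in>others i. x (g j) j) \<in> measurable (PiM ?A ?P) (PiM (others i) (\<lambda>_. S))"
      using gi by (intro measurable_restrict *) (auto simp: others_def)
    show "(\<lambda>x. \<lambda>j\<in>{i}. x (g j) j) \<in> measurable (PiM ?B ?P) (PiM {i} (\<lambda>_. S))"
      using i by (intro measurable_restrict *) auto
  qed
  also have "(\<lambda>x. \<lambda>j\<in>others i. x (g j) j) \<circ> (\<lambda>\<omega>. restrict (\<lambda>k. ?X k \<omega>) ?A) = (\<lambda>\<omega>. \<lambda>j\<in>others i. W j \<omega>)"
    using gi by (auto simp: fun_eq_iff others_def cluster_def restrict_def)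
  also have "(\<lambda>x. \<lambda>j\<in>{i}. x (g j) j) \<circ> (\<lambda>\<omega>. restrict (\<lambda>k. ?X k \<omega>) ?B) = (\<lambda>\<omega>. \<lambda>j\<in>{i}. W j \<omega>)"
    using i by (auto simp: fun_eq_iff cluster_def restrict_def)
  finally show ?thesis .
qed

text \<open>Unit \<open>i\<close> is integrated out while all units of the other clusters stay jointly fixed.\<close>

lemma fresh_iterated_integral:
  fixes F :: "(nat \<Rightarrow> 'a) \<Rightarrow> 'a \<Rightarrow> real"
  assumes i: "i \<in> {1..n}"
    and F: "(\<lambda>(x, y). F x y) \<in> borel_measurable (PiM (others i) (\<lambda>_. S) \<Otimes>\<^sub>M S)"
    and int: "integrable M (\<lambda>\<omega>. F (\<lambda>j\<in>others i. W j \<omega>) (W i \<omega>))"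
  shows "integrable M (\<lambda>\<omega>. \<integral>\<omega>'. F (\<lambda>j\<in>others i. W j \<omega>) (W i \<omega>') \<partial>M)"
    and "expectation (\<lambda>\<omega>. F (\<lambda>j\<in>others i. W j \<omega>) (W i \<omega>))
      = expectation (\<lambda>\<omega>. \<integral>\<omega>'. F (\<lambda>j\<in>others i. W j \<omega>) (W i \<omega>') \<partial>M)"
proof -
  have f: "(\<lambda>z. F (fst z) (snd z i)) \<in> borel_measurable (PiM (others i) (\<lambda>_. S) \<Otimes>\<^sub>M PiM {i} (\<lambda>_. S))"
  proof -
    have "(\<lambda>z. (fst z, snd z i)) \<in> measurable (PiM (others i) (\<lambda>_. S) \<Otimes>\<^sub>M PiM {i} (\<lambda>_. S))
        (PiM (others i) (\<lambda>_. S) \<Otimes>\<^sub>M S)"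
      by (intro measurable_Pair measurable_fst measurable_compose[OF measurable_snd]
          measurable_component_singleton) auto
    from measurable_compose[OF this F] show ?thesis by simp
  qed
  have int': "integrable M (\<lambda>\<omega>. (\<lambda>z. F (fst z) (snd z i)) (\<lambda>j\<in>others i. W j \<omega>, \<lambda>j\<in>{i}. W j \<omega>))"
    using int by simp
  show "integrable M (\<lambda>\<omega>. \<integral>\<omega>'. F (\<lambda>j\<in>others i. W j \<omega>) (W i \<omega>') \<partial>M)"
    using indep_var_iterated_integral(1)[OF indep_others[OF i] f int']
    by (simp del: restrict_apply add: restrict_apply')
  show "expectation (\<lambda>\<omega>. F (\<lambda>j\<in>others i. W j \<omega>) (W i \<omega>))
      = expectation (\<lambda>\<omega>. \<integral>\<omega>'. F (\<lambda>j\<in>others i. W j \<omega>) (W i \<omega>') \<partial>M)"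
    using indep_var_iterated_integral(2)[OF indep_others[OF i] f int']
    by (simp del: restrict_apply add: restrict_apply')
qed

lemma othersD: "j \<in> others i \<Longrightarrow> j \<in> {1..n}" "j \<in> others i \<Longrightarrow> g j \<noteq> g i"
  by (auto simp: others_def)

lemma finite_others[simp]: "finite (others i)"
  by (simp add: others_def)

lemma kernel_integrable:
  assumes "i \<in> {1..n}" "j \<in> {1..n}"
  shows "integrable M (\<lambda>\<omega>. \<phi> (W i \<omega>) (W j \<omega>))"
  by (rule square_integrable_imp_integrable[OF kernel_W_measurable kernel_square_integrable]) fact+

lemma kernel_expectation_zero:
  assumes "i \<in> {1..n}" "j \<in> others i"
  shows "expectation (\<lambda>\<omega>. \<phi> (W i \<omega>) (W j \<omega>)) = 0"
  using kernel_centred[of i j] assms by (auto simp: others_def has_bochner_integral_iff)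

lemma component_measurable:
  "j \<in> J \<Longrightarrow> (\<lambda>z. fst z j) \<in> measurable (PiM J (\<lambda>_. S) \<Otimes>\<^sub>M S) S"
  by (rule measurable_compose[OF measurable_fst], rule measurable_component_singleton)

text \<open>Here \<open>j\<close> is the unit integrated out and \<open>i\<close> belongs to
  \<open>others j\<close>. With indicators for \<open>q\<close> this is the defining property of
  conditional expectation given \<open>W i\<close>; with \<open>q = 1\<close> it gives integrability
  and mean of \<open>h j (W i)\<close>.\<close>

lemma kernel_iterated_integral:
  assumes i: "i \<in> {1..n}" and j: "j \<in> others i" and q: "q \<in> borel_measurable S"
    and int: "integrable M (\<lambda>\<omega>. q (W i \<omega>) * \<phi> (W i \<omega>) (W j \<omega>))"
  shows "integrable M (\<lambda>\<omega>. q (W i \<omega>) * h j (W i \<omega>))"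
    and "expectation (\<lambda>\<omega>. q (W i \<omega>) * \<phi> (W i \<omega>) (W j \<omega>)) = expectation (\<lambda>\<omega>. q (W i \<omega>) * h j (W i \<omega>))"
proof -
  have j': "j \<in> {1..n}" and ij: "i \<in> others j"
    using i j by (auto simp: others_def)
  note [measurable] = component_measurable[OF ij] q
  have m: "(\<lambda>(z, y). q (z i) * \<phi> (z i) y) \<in> borel_measurable (PiM (others j) (\<lambda>_. S) \<Otimes>\<^sub>M S)"
    unfolding case_prod_beta by measurable
  show "integrable M (\<lambda>\<omega>. q (W i \<omega>) * h j (W i \<omega>))"
    using fresh_iterated_integral(1)[OF j' m] int ij by (simp add: h_def)
  show "expectation (\<lambda>\<omega>. q (W i \<omega>) * \<phi> (W i \<omega>) (W j \<omega>)) = expectation (\<lambda>\<omega>. q (W i \<omega>) * h j (W i \<omega>))"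
    using fresh_iterated_integral(2)[OF j' m] int ij by (simp add: h_def)
qed

lemma finite_measure_subalgebra_W:
  "i \<in> {1..n} \<Longrightarrow> finite_measure_subalgebra M (vimage_algebra (space M) (W i) S)"
  by (rule finite_measure_subalgebra_vimage[OF finite_measure_axioms W_measurable])

lemma h_integrable:
  assumes i: "i \<in> {1..n}" and j: "j \<in> others i"
  shows "integrable M (\<lambda>\<omega>. h j (W i \<omega>))"
  using kernel_iterated_integral(1)[OF i j, of "\<lambda>_. 1"] kernel_integrable[OF i othersD(1)[OF j]]
  by simp

lemma h_expectation_zero:
  assumes i: "i \<in> {1..n}" and j: "j \<in> others i"
  shows "expectation (\<lambda>\<omega>. h j (W i \<omega>)) = 0"
  using kernel_iterated_integral(2)[OF i j, of "\<lambda>_. 1"] kernel_integrable[OF i othersD(1)[OF j]]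
    kernel_expectation_zero[OF i j]
  by simp

text \<open>An event generated by \<open>W i\<close> is a preimage, so its indicator is a function
  of \<open>W i\<close> and can serve as the test function in
  \<open>kernel_iterated_integral\<close>.\<close>

lemma kernel_proj_AE:
  assumes i: "i \<in> {1..n}" and j: "j \<in> others i"
  shows "AE \<omega> in M. kernel_proj M S \<phi> W j i \<omega> = h j (W i \<omega>)"
proof -
  interpret F: finite_measure_subalgebra M "vimage_algebra (space M) (W i) S"
    by (rule finite_measure_subalgebra_W[OF i])
  have j': "j \<in> {1..n}" using j by (rule othersD)
  have Wi: "W i \<in> space M \<rightarrow> space S"
    using W_measurable[OF i] by (auto dest: measurable_space)
  show ?thesis
    unfolding kernel_proj_def
  proof (rule F.real_cond_exp_charact)
    show "integrable M (\<lambda>\<omega>. \<phi> (W i \<omega>) (W j \<omega>))" by (rule kernel_integrable[OF i j'])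
    show "integrable M (\<lambda>\<omega>. h j (W i \<omega>))" by (rule h_integrable[OF i j])
    show "(\<lambda>\<omega>. h j (W i \<omega>)) \<in> borel_measurable (vimage_algebra (space M) (W i) S)"
      by (rule measurable_compose[OF measurable_vimage_algebra1[OF Wi] h_measurable[OF j']])
    fix A assume "A \<in> sets (vimage_algebra (space M) (W i) S)"
    then obtain B where B: "B \<in> sets S" "A = W i -` B \<inter> space M"
      using Wi by (auto simp: sets_vimage_algebra2)
    have ind: "indicator A \<omega> = (indicator B (W i \<omega>) :: real)" if "\<omega> \<in> space M" for \<omega>
      using that B by (auto simp: indicator_def)
    have eq: "(\<integral>\<omega>\<in>A. f \<omega> \<partial>M) = expectation (\<lambda>\<omega>. indicator B (W i \<omega>) * f \<omega>)" for f :: "_ \<Rightarrow> real"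
      unfolding set_lebesgue_integral_def by (rule Bochner_Integration.integral_cong) (simp_all add: ind)
    have A: "A \<in> sets M"
      using B W_measurable[OF i] by (auto intro: measurable_sets)
    have "integrable M (\<lambda>\<omega>. indicator A \<omega> * \<phi> (W i \<omega>) (W j \<omega>))"
      using integrable_mult_indicator[OF A kernel_integrable[OF i j']] by simp
    then have "integrable M (\<lambda>\<omega>. indicator B (W i \<omega>) * \<phi> (W i \<omega>) (W j \<omega>))"
      by (rule Bochner_Integration.integrable_cong[THEN iffD1, OF refl, rotated]) (simp add: ind)
    then show "(\<integral>\<omega>\<in>A. \<phi> (W i \<omega>) (W j \<omega>) \<partial>M) = (\<integral>\<omega>\<in>A. h j (W i \<omega>) \<partial>M)"
      unfolding eq using B by (intro kernel_iterated_integral(2) i j) auto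
  qed
qed

lemma kernel_proj_measurable[measurable]: "kernel_proj M S \<phi> W j i \<in> borel_measurable M"
  unfolding kernel_proj_def by (rule borel_measurable_cond_exp2)

text \<open>Conditional Jensen holds for \<open>kernel_proj\<close>; almost-everywhere equality
  moves it to \<open>h\<close>.\<close>

lemma expectation_convex_h_le:
  fixes q :: "real \<Rightarrow> real"
  assumes i: "i \<in> {1..n}" and j: "j \<in> others i"
    and q: "convex_on UNIV q" "q \<in> borel_measurable borel"
    and int: "integrable M (\<lambda>\<omega>. q (\<phi> (W i \<omega>) (W j \<omega>)))"
  shows "integrable M (\<lambda>\<omega>. q (h j (W i \<omega>)))"
    and "expectation (\<lambda>\<omega>. q (h j (W i \<omega>))) \<le> expectation (\<lambda>\<omega>. q (\<phi> (W i \<omega>) (W j \<omega>)))"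
proof -
  interpret F: finite_measure_subalgebra M "vimage_algebra (space M) (W i) S"
    by (rule finite_measure_subalgebra_W[OF i])
  have j': "j \<in> {1..n}" using j by (rule othersD)
  have AE: "AE \<omega> in M. q (kernel_proj M S \<phi> W j i \<omega>) = q (h j (W i \<omega>))"
    using kernel_proj_AE[OF i j] by eventually_elim simp
  have m1: "(\<lambda>\<omega>. q (kernel_proj M S \<phi> W j i \<omega>)) \<in> borel_measurable M"
    by (rule measurable_compose[OF kernel_proj_measurable q(2)])
  have m2: "(\<lambda>\<omega>. q (h j (W i \<omega>))) \<in> borel_measurable M"
    by (rule measurable_compose[OF h_W_measurable[OF i j'] q(2)])
  note le = F.expectation_convex_cond_exp_le[OF kernel_integrable[OF i j'] int q, folded kernel_proj_def]
  show "integrable M (\<lambda>\<omega>. q (h j (W i \<omega>)))"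
    using le(1) integrable_cong_AE[OF m1 m2 AE] by simp
  show "expectation (\<lambda>\<omega>. q (h j (W i \<omega>))) \<le> expectation (\<lambda>\<omega>. q (\<phi> (W i \<omega>) (W j \<omega>)))"
    using le(2) integral_cong_AE[OF m1 m2 AE] by simp
qed

section \<open>Averaged projections and cluster totals\<close>

text \<open>\<open>H i (W i)\<close> is the corresponding version of \<open>avg_proj\<close>, with value \<open>0\<close> if \<open>others i\<close> is empty.\<close>

definition H :: "nat \<Rightarrow> 'a \<Rightarrow> real" where
  "H i x = (\<Sum>j\<in>others i. h j x) / real (card (others i))"

lemma H_measurable: "H i \<in> borel_measurable S"
  unfolding H_def[abs_def]
  by (intro borel_measurable_divide borel_measurable_sum h_measurable) (auto dest: othersD)

lemma H_W_measurable: "i \<in> {1..n} \<Longrightarrow> (\<lambda>\<omega>. H i (W i \<omega>)) \<in> borel_measurable M"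
  by (rule measurable_compose[OF W_measurable H_measurable])

lemma proj_measurable: "proj i \<in> borel_measurable M"
  unfolding proj_eq[abs_def] by measurable

lemma proj_AE:
  assumes i: "i \<in> {1..n}"
  shows "AE \<omega> in M. proj i \<omega> = H i (W i \<omega>)"
proof -
  have "AE \<omega> in M. \<forall>j\<in>others i. kernel_proj M S \<phi> W j i \<omega> = h j (W i \<omega>)"
    by (rule AE_finite_allI) (auto intro: kernel_proj_AE[OF i])
  then show ?thesis
    by eventually_elim (simp add: proj_eq H_def)
qed

lemma H_integrable: "i \<in> {1..n} \<Longrightarrow> integrable M (\<lambda>\<omega>. H i (W i \<omega>))"
  unfolding H_def by (intro integrable_divide Bochner_Integration.integrable_sum h_integrable)

lemma H_expectation_zero: "i \<in> {1..n} \<Longrightarrow> expectation (\<lambda>\<omega>. H i (W i \<omega>)) = 0"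
  unfolding H_def using h_integrable h_expectation_zero
  by (simp add: Bochner_Integration.integral_sum)

definition Y :: "nat \<Rightarrow> 'w \<Rightarrow> real" where
  "Y k \<omega> = (\<Sum>i\<in>cluster n g k. H i (W i \<omega>))"

lemma clusterD: "i \<in> cluster n g k \<Longrightarrow> i \<in> {1..n}" "i \<in> cluster n g k \<Longrightarrow> g i = k"
  by (auto simp: cluster_def)

lemma Y_measurable: "Y k \<in> borel_measurable M"
  unfolding Y_def[abs_def] by (intro borel_measurable_sum H_W_measurable) (rule clusterD)

lemma Y_integrable: "integrable M (Y k)"
  unfolding Y_def[abs_def] by (intro Bochner_Integration.integrable_sum H_integrable) (rule clusterD)

lemma Y_expectation_zero: "expectation (Y k) = 0"
  unfolding Y_def[abs_def]
  by (subst Bochner_Integration.integral_sum)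
    (auto intro!: sum.neutral H_expectation_zero intro: H_integrable clusterD simp del: atLeastAtMost_iff)

text \<open>The pointwise form of \<open>H\<close> makes \<open>Y k\<close> a measurable function of
  the block of cluster \<open>k\<close> alone, so independence of the blocks is inherited.\<close>

lemma Y_indep: "indep_vars (\<lambda>_. borel) Y {1..G}"
proof -
  have "indep_vars (\<lambda>_. borel)
      (\<lambda>k \<omega>. (\<lambda>x. \<Sum>i\<in>cluster n g k. H i (x i)) (\<lambda>i\<in>cluster n g k. W i \<omega>)) {1..G}"
    using indep_clusters unfolding indep_across_clusters_def
  proof (rule indep_vars_compose2)
    show "(\<lambda>x. \<Sum>i\<in>cluster n g k. H i (x i)) \<in> borel_measurable (PiM (cluster n g k) (\<lambda>_. S))" for k
      by (intro borel_measurable_sum measurable_compose[OF _ H_measurable] measurable_component_singleton)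
  qed
  then show ?thesis
    by (simp add: Y_def[abs_def])
qed

context
  fixes q :: "real \<Rightarrow> real" and b :: real
  assumes q: "convex_on UNIV q" "q \<in> borel_measurable borel" "\<And>x. 0 \<le> q x" "q 0 = 0"
    and int: "\<And>i j. i \<in> {1..n} \<Longrightarrow> j \<in> {1..n} \<Longrightarrow> integrable M (\<lambda>\<omega>. q (\<phi> (W i \<omega>) (W j \<omega>)))"
    and le: "\<And>i j. i \<in> {1..n} \<Longrightarrow> j \<in> {1..n} \<Longrightarrow> expectation (\<lambda>\<omega>. q (\<phi> (W i \<omega>) (W j \<omega>))) \<le> b"
begin

text \<open>Jensen is applied to the projection and then to the average over
  \<open>others i\<close>; \<open>q 0 = 0\<close> covers an empty \<open>others i\<close>. The
  context is used with the square, for variance bounds, and with the soft threshold power, for the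
  Lindeberg condition.\<close>

lemma expectation_convex_H_le:
  assumes i: "i \<in> {1..n}"
  shows "integrable M (\<lambda>\<omega>. q (H i (W i \<omega>)))"
    and "expectation (\<lambda>\<omega>. q (H i (W i \<omega>))) \<le> b"
proof -
  have b: "0 \<le> b"
    using order_trans[OF _ le[OF i i]] q(3) by simp
  have "integrable M (\<lambda>\<omega>. q (H i (W i \<omega>))) \<and> expectation (\<lambda>\<omega>. q (H i (W i \<omega>))) \<le> b"
  proof (cases "others i = {}")
    case True
    then show ?thesis using b q(4) by (simp add: H_def)
  next
    case False
    have *: "integrable M (\<lambda>\<omega>. q (h j (W i \<omega>)))" "expectation (\<lambda>\<omega>. q (h j (W i \<omega>))) \<le> b"
      if j: "j \<in> others i" for j
    proof -
      show "integrable M (\<lambda>\<omega>. q (h j (W i \<omega>)))"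
        by (rule expectation_convex_h_le(1)[OF i j q(1,2) int[OF i othersD(1)[OF j]]])
      have "expectation (\<lambda>\<omega>. q (h j (W i \<omega>))) \<le> expectation (\<lambda>\<omega>. q (\<phi> (W i \<omega>) (W j \<omega>)))"
        by (rule expectation_convex_h_le(2)[OF i j q(1,2) int[OF i othersD(1)[OF j]]])
      also have "\<dots> \<le> b" by (rule le[OF i othersD(1)[OF j]])
      finally show "expectation (\<lambda>\<omega>. q (h j (W i \<omega>))) \<le> b" .
    qed
    have m: "(\<lambda>\<omega>. h j (W i \<omega>)) \<in> borel_measurable M" if "j \<in> others i" for j
      using that by (intro h_W_measurable i othersD(1))
    show ?thesis
      unfolding H_def
      using expectation_convex_mean_le[OF q(1,2,3) finite_others False, of "\<lambda>j \<omega>. h j (W i \<omega>)" b] m *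
      by simp
  qed
  then show "integrable M (\<lambda>\<omega>. q (H i (W i \<omega>)))" "expectation (\<lambda>\<omega>. q (H i (W i \<omega>))) \<le> b"
    by auto
qed

text \<open>Dividing by the cluster size makes the total an average, so one more use of Jensen keeps
  the bound \<open>b\<close> under arbitrary dependence inside the cluster.\<close>

lemma expectation_convex_Y_le:
  assumes k: "k \<in> {1..G}"
  shows "integrable M (\<lambda>\<omega>. q (Y k \<omega> / real (size k)))"
    and "expectation (\<lambda>\<omega>. q (Y k \<omega> / real (size k))) \<le> b"
  unfolding Y_def cluster_size_def
  using expectation_convex_mean_le[OF q(1,2,3) finite_cluster cluster_nonempty[OF k],
      of "\<lambda>i \<omega>. H i (W i \<omega>)" b] expectation_convex_H_le H_W_measurable clusterD(1)
  by blast+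

end

section \<open>Orthogonality and second moments of the remainders\<close>

text \<open>This holds for every \<open>y\<close>, not just almost every one, since the integral of a
  non-integrable section is \<open>0\<close>.\<close>

lemma kernel_section_expectation:
  assumes i: "i \<in> {1..n}" and j: "j \<in> others i" and y: "y \<in> space S"
  shows "expectation (\<lambda>\<omega>. \<phi> (W i \<omega>) y - h j (W i \<omega>) - h i y) = 0"
proof (cases "integrable M (\<lambda>\<omega>. \<phi> (W i \<omega>) y)")
  case True
  have "expectation (\<lambda>\<omega>. \<phi> (W i \<omega>) y) = h i y"
    unfolding h_def using y W_measurable[OF i]
    by (intro Bochner_Integration.integral_cong) (auto intro!: kernel_symmetric dest: measurable_space)
  then show ?thesis
    using True h_integrable[OF i j] h_expectation_zero[OF i j] by (simp add: prob_space)
next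
  case False
  have "\<not> integrable M (\<lambda>\<omega>. \<phi> (W i \<omega>) y - h j (W i \<omega>) - h i y)"
  proof
    assume "integrable M (\<lambda>\<omega>. \<phi> (W i \<omega>) y - h j (W i \<omega>) - h i y)"
    then have "integrable M (\<lambda>\<omega>. (\<phi> (W i \<omega>) y - h j (W i \<omega>) - h i y) + (h j (W i \<omega>) + h i y))"
      using h_integrable[OF i j] by (intro Bochner_Integration.integrable_add) auto
    with False show False by simp
  qed
  then show ?thesis by (rule not_integrable_integral_eq)
qed

lemma remainder_measurable:
  assumes "i \<in> {1..n}" "j \<in> {1..n}"
  shows "remainder i j \<in> borel_measurable M"
  unfolding remainder_def[abs_def]
  by (intro borel_measurable_diff kernel_W_measurable h_W_measurable assms)

lemma remainder_commute:
  assumes "i \<in> {1..n}" "j \<in> {1..n}" "\<omega> \<in> space M"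
  shows "remainder i j \<omega> = remainder j i \<omega>"
proof -
  have "W i \<omega> \<in> space S" "W j \<omega> \<in> space S"
    using assms W_measurable by (auto dest: measurable_space)
  then show ?thesis
    unfolding remainder_def using kernel_symmetric[of "W i \<omega>" "W j \<omega>"] by simp
qed

context
  fixes B :: real
  assumes B: "\<And>i j. i \<in> {1..n} \<Longrightarrow> j \<in> {1..n} \<Longrightarrow> expectation (\<lambda>\<omega>. (\<phi> (W i \<omega>) (W j \<omega>))\<^sup>2) \<le> B"
begin

lemma B_nonneg: "0 \<le> B"
  using order_trans[OF _ B[of 1 1]] n_ge_1 by simp

lemma h_square:
  assumes i: "i \<in> {1..n}" and j: "j \<in> others i"
  shows "integrable M (\<lambda>\<omega>. (h j (W i \<omega>))\<^sup>2)" "expectation (\<lambda>\<omega>. (h j (W i \<omega>))\<^sup>2) \<le> B"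
proof -
  have j': "j \<in> {1..n}" using j by (rule othersD)
  note * = expectation_convex_h_le[OF i j convex_power2 _ kernel_square_integrable[OF i j']]
  show "integrable M (\<lambda>\<omega>. (h j (W i \<omega>))\<^sup>2)" by (rule *) simp
  have "expectation (\<lambda>\<omega>. (h j (W i \<omega>))\<^sup>2) \<le> expectation (\<lambda>\<omega>. (\<phi> (W i \<omega>) (W j \<omega>))\<^sup>2)"
    by (rule *) simp
  then show "expectation (\<lambda>\<omega>. (h j (W i \<omega>))\<^sup>2) \<le> B"
    using B[OF i j'] by simp
qed

lemma H_square:
  assumes "i \<in> {1..n}"
  shows "integrable M (\<lambda>\<omega>. (H i (W i \<omega>))\<^sup>2)" "expectation (\<lambda>\<omega>. (H i (W i \<omega>))\<^sup>2) \<le> B"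
  using expectation_convex_H_le[of power2 B, OF convex_power2 _ _ _ kernel_square_integrable B assms]
  by simp_all

lemma Y_square:
  assumes k: "k \<in> {1..G}"
  shows "integrable M (\<lambda>\<omega>. (Y k \<omega>)\<^sup>2)" "expectation (\<lambda>\<omega>. (Y k \<omega>)\<^sup>2) \<le> (real (size k))\<^sup>2 * B"
proof -
  note * = expectation_convex_Y_le[of power2 B, OF convex_power2 _ _ _ kernel_square_integrable B k]
  have s: "real (size k) > 0" using size_pos[OF k] by simp
  have eq: "(Y k \<omega>)\<^sup>2 = (real (size k))\<^sup>2 * (Y k \<omega> / real (size k))\<^sup>2" for \<omega>
    using s by (simp add: power_divide)
  show "integrable M (\<lambda>\<omega>. (Y k \<omega>)\<^sup>2)"
    unfolding eq by (intro integrable_mult_right *(1)) auto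
  show "expectation (\<lambda>\<omega>. (Y k \<omega>)\<^sup>2) \<le> (real (size k))\<^sup>2 * B"
    unfolding eq integral_mult_right_zero by (intro mult_left_mono *(2)) auto
qed

lemma remainder_square:
  assumes i: "i \<in> {1..n}" and j: "j \<in> others i"
  shows "integrable M (\<lambda>\<omega>. (remainder i j \<omega>)\<^sup>2)" "expectation (\<lambda>\<omega>. (remainder i j \<omega>)\<^sup>2) \<le> 9 * B"
proof -
  have j': "j \<in> {1..n}" and ji: "i \<in> others j" using i j by (auto simp: others_def)
  note ints = kernel_square_integrable[OF i j'] h_square(1)[OF i j] h_square(1)[OF j' ji]
  let ?b = "\<lambda>\<omega>. 3 * ((\<phi> (W i \<omega>) (W j \<omega>))\<^sup>2 + (h j (W i \<omega>))\<^sup>2 + (h i (W j \<omega>))\<^sup>2)"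
  have b: "integrable M ?b"
    using ints by auto
  \<comment> \<open>The right side minus the left is the sum of the three squares supplied
    below.\<close>
  have le: "(a - b - c)\<^sup>2 \<le> 3 * (a\<^sup>2 + b\<^sup>2 + c\<^sup>2)" for a b c :: real
    using zero_le_power2[of "a + b"] zero_le_power2[of "a + c"] zero_le_power2[of "b - c"]
    unfolding power2_eq_square by (simp add: algebra_simps)
  show i': "integrable M (\<lambda>\<omega>. (remainder i j \<omega>)\<^sup>2)"
  proof (rule Bochner_Integration.integrable_bound[OF b])
    show "(\<lambda>\<omega>. (remainder i j \<omega>)\<^sup>2) \<in> borel_measurable M"
      using remainder_measurable[OF i j'] by measurable
  qed (use le in \<open>auto simp: remainder_def\<close>)
  have "expectation (\<lambda>\<omega>. (remainder i j \<omega>)\<^sup>2) \<le> expectation ?b"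
    using le by (intro integral_mono i' b) (auto simp: remainder_def)
  also have "\<dots> \<le> 3 * (B + B + B)"
    using ints B[OF i j'] h_square(2)[OF i j] h_square(2)[OF j' ji] by simp
  finally show "expectation (\<lambda>\<omega>. (remainder i j \<omega>)\<^sup>2) \<le> 9 * B" by simp
qed

lemma remainder_mult_integrable:
  assumes "i \<in> {1..n}" "j \<in> others i" "k \<in> {1..n}" "l \<in> others k"
  shows "integrable M (\<lambda>\<omega>. remainder i j \<omega> * remainder k l \<omega>)"
    and "expectation (\<lambda>\<omega>. remainder i j \<omega> * remainder k l \<omega>) \<le> 9 * B"
proof -
  have m: "remainder i j \<in> borel_measurable M" "remainder k l \<in> borel_measurable M"
    using assms by (auto intro!: remainder_measurable dest: othersD)
  have le: "\<bar>a * b\<bar> \<le> (a\<^sup>2 + b\<^sup>2) / 2" for a b :: real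
    using sum_squares_bound[of a b] sum_squares_bound[of a "-b"] by (auto simp: abs_le_iff)
  let ?b = "\<lambda>\<omega>. ((remainder i j \<omega>)\<^sup>2 + (remainder k l \<omega>)\<^sup>2) / 2"
  have b: "integrable M ?b"
    using remainder_square(1) assms by auto
  show int: "integrable M (\<lambda>\<omega>. remainder i j \<omega> * remainder k l \<omega>)"
    by (rule Bochner_Integration.integrable_bound[OF b]) (use m le in auto)
  have "expectation (\<lambda>\<omega>. remainder i j \<omega> * remainder k l \<omega>) \<le> expectation ?b"
    using abs_le_D1[OF le] by (intro integral_mono int b)
  also have "\<dots> \<le> (9 * B + 9 * B) / 2"
    using remainder_square[OF assms(1,2)] remainder_square[OF assms(3,4)] by simp
  finally show "expectation (\<lambda>\<omega>. remainder i j \<omega> * remainder k l \<omega>) \<le> 9 * B" by simp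
qed

text \<open>The cluster of \<open>i\<close> is disjoint from those of \<open>j\<close>,
  \<open>k\<close> and \<open>l\<close>. With the other clusters held fixed, the second factor is
  constant and the integral of the first over unit \<open>i\<close> vanishes by
  \<open>kernel_section_expectation\<close>. The units \<open>j\<close>, \<open>k\<close>,
  \<open>l\<close> stay jointly fixed, so \<open>j\<close> may share a cluster with \<open>k\<close>
  or \<open>l\<close>.\<close>

lemma remainder_orthogonal_aux:
  assumes i: "i \<in> {1..n}" and j: "j \<in> others i" and k: "k \<in> others i" and l: "l \<in> others i" "l \<in> others k"
  shows "expectation (\<lambda>\<omega>. remainder i j \<omega> * remainder k l \<omega>) = 0"
proof -
  have r: "j \<in> {1..n}" "k \<in> {1..n}" "l \<in> {1..n}" using j k l by (auto dest: othersD)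
  define F where "F z x = (\<phi> x (z j) - h j x - h i (z j)) * (\<phi> (z k) (z l) - h l (z k) - h k (z l))" for z x
  note [measurable] = component_measurable[OF j] component_measurable[OF k] component_measurable[OF l(1)]
    h_measurable[OF i] h_measurable[OF r(1)] h_measurable[OF r(2)] h_measurable[OF r(3)]
  have m: "(\<lambda>(z, x). F z x) \<in> borel_measurable (PiM (others i) (\<lambda>_. S) \<Otimes>\<^sub>M S)"
    unfolding case_prod_beta F_def by measurable
  have eq: "F (\<lambda>j\<in>others i. W j \<omega>) (W i \<omega>') =
      (\<phi> (W i \<omega>') (W j \<omega>) - h j (W i \<omega>') - h i (W j \<omega>)) * remainder k l \<omega>" for \<omega> \<omega>'
    using j k l by (simp add: F_def remainder_def)
  then have eq': "F (\<lambda>j\<in>others i. W j \<omega>) (W i \<omega>) = remainder i j \<omega> * remainder k l \<omega>" for \<omega>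
    by (simp add: remainder_def)
  have "expectation (\<lambda>\<omega>. remainder i j \<omega> * remainder k l \<omega>)
     = expectation (\<lambda>\<omega>. \<integral>\<omega>'. (\<phi> (W i \<omega>') (W j \<omega>) - h j (W i \<omega>') - h i (W j \<omega>)) * remainder k l \<omega> \<partial>M)"
    using fresh_iterated_integral(2)[OF i m] remainder_mult_integrable(1)[OF i j r(2) l(2)]
    unfolding eq' eq by blast
  also have "\<dots> = expectation (\<lambda>\<omega>. 0)"
    using W_measurable[OF r(1)]
    by (intro Bochner_Integration.integral_cong refl)
      (auto simp: kernel_section_expectation[OF i j] dest: measurable_space)
  finally show ?thesis by simp
qed

text \<open>Two different two-element sets of clusters leave \<open>g i\<close> or
  \<open>g j\<close> outside the second one; by symmetry of the remainder the isolated unit can be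
  put first.\<close>

lemma remainder_orthogonal:
  assumes i: "i \<in> {1..n}" and j: "j \<in> others i" and k: "k \<in> {1..n}" and l: "l \<in> others k"
    and ne: "{g i, g j} \<noteq> {g k, g l}"
  shows "expectation (\<lambda>\<omega>. remainder i j \<omega> * remainder k l \<omega>) = 0"
proof -
  have r: "j \<in> {1..n}" "l \<in> {1..n}" "g i \<noteq> g j" "g k \<noteq> g l" using j l by (auto simp: others_def)
  show ?thesis
  proof (cases "g i \<in> {g k, g l}")
    case False
    then show ?thesis
      using i j k l r by (intro remainder_orthogonal_aux) (auto simp: others_def)
  next
    case True
    then have gj: "g j \<notin> {g k, g l}" using ne r by auto
    have "expectation (\<lambda>\<omega>. remainder i j \<omega> * remainder k l \<omega>) = expectation (\<lambda>\<omega>. remainder j i \<omega> * remainder k l \<omega>)"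
      using remainder_commute[OF i r(1)] by (intro Bochner_Integration.integral_cong) auto
    also have "\<dots> = 0"
      using i j k l r gj by (intro remainder_orthogonal_aux) (auto simp: others_def)
    finally show ?thesis .
  qed
qed

lemma remainder_sum_square:
  shows "integrable M (\<lambda>\<omega>. (\<Sum>i\<in>{1..n}. \<Sum>j\<in>others i. remainder i j \<omega>)\<^sup>2)"
    and "expectation (\<lambda>\<omega>. (\<Sum>i\<in>{1..n}. \<Sum>j\<in>others i. remainder i j \<omega>)\<^sup>2) \<le> (5 * real n * real m)\<^sup>2 * B"
proof -
  define P where "P = Sigma {1..n} others"
  define R where "R p = remainder (fst p) (snd p)" for p
  have P: "finite P" by (simp add: P_def)
  have PD: "fst p \<in> {1..n}" "snd p \<in> others (fst p)" if "p \<in> P" for p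
    using that by (auto simp: P_def)
  have eq: "(\<Sum>i\<in>{1..n}. \<Sum>j\<in>others i. remainder i j \<omega>)\<^sup>2 = (\<Sum>p\<in>P. \<Sum>p'\<in>P. R p \<omega> * R p' \<omega>)" for \<omega>
    unfolding P_def R_def by (subst sum.Sigma) (auto simp: power2_eq_square sum_product case_prod_beta)
  have int: "integrable M (\<lambda>\<omega>. R p \<omega> * R p' \<omega>)" if "p \<in> P" "p' \<in> P" for p p'
    unfolding R_def using that PD by (intro remainder_mult_integrable) auto
  show "integrable M (\<lambda>\<omega>. (\<Sum>i\<in>{1..n}. \<Sum>j\<in>others i. remainder i j \<omega>)\<^sup>2)"
    unfolding eq by (intro Bochner_Integration.integrable_sum int)
  \<comment> \<open>The ordered pairs of units lying in the same two clusters as \<open>p\<close>,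
    in either order; only these can correlate with \<open>R p\<close>.\<close>
  define Q where "Q p = cluster n g (g (fst p)) \<times> cluster n g (g (snd p))
      \<union> cluster n g (g (snd p)) \<times> cluster n g (g (fst p))" for p
  have cardQ: "real (card (Q p \<inter> P)) \<le> 2 * (real m)\<^sup>2" if p: "p \<in> P" for p
  proof -
    have "card (Q p \<inter> P) \<le> card (Q p)"
      by (rule card_mono) (auto simp: Q_def)
    also have "\<dots> \<le> size (g (fst p)) * size (g (snd p)) + size (g (snd p)) * size (g (fst p))"
      unfolding Q_def cluster_size_def by (rule order_trans[OF card_Un_le]) (simp add: card_cartesian_product)
    also have "\<dots> \<le> m * m + m * m"
      using PD[OF p] by (intro add_mono mult_le_mono size_le_max) (auto dest: othersD)
    finally have "real (card (Q p \<inter> P)) \<le> real (m * m + m * m)" by (rule of_nat_mono)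
    then show ?thesis by (simp add: power2_eq_square)
  qed
  have inner: "(\<Sum>p'\<in>P. expectation (\<lambda>\<omega>. R p \<omega> * R p' \<omega>)) \<le> 2 * (real m)\<^sup>2 * (9 * B)" if p: "p \<in> P" for p
  proof -
    have "(\<Sum>p'\<in>P. expectation (\<lambda>\<omega>. R p \<omega> * R p' \<omega>)) = (\<Sum>p'\<in>Q p \<inter> P. expectation (\<lambda>\<omega>. R p \<omega> * R p' \<omega>))"
    proof (rule sum.mono_neutral_right[OF P])
      show "\<forall>p'\<in>P - Q p \<inter> P. expectation (\<lambda>\<omega>. R p \<omega> * R p' \<omega>) = 0"
      proof
        fix p' assume p': "p' \<in> P - Q p \<inter> P"
        then have "{g (fst p), g (snd p)} \<noteq> {g (fst p'), g (snd p')}"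
          using PD[of p'] by (cases p') (auto simp: Q_def cluster_def doubleton_eq_iff dest: othersD)
        then show "expectation (\<lambda>\<omega>. R p \<omega> * R p' \<omega>) = 0"
          unfolding R_def using PD[OF p] PD[of p'] p' by (intro remainder_orthogonal) auto
      qed
    qed auto
    also have "\<dots> \<le> real (card (Q p \<inter> P)) * (9 * B)"
      using PD[OF p] PD unfolding R_def by (intro sum_bounded_above remainder_mult_integrable) auto
    also have "\<dots> \<le> 2 * (real m)\<^sup>2 * (9 * B)"
      using B_nonneg by (intro mult_right_mono cardQ p) auto
    finally show ?thesis .
  qed
  have cardP: "real (card P) \<le> (real n)\<^sup>2"
  proof -
    have "card P \<le> card ({1..n} \<times> {1..n})"
      by (rule card_mono) (auto simp: P_def dest: othersD)
    then have "card P \<le> n * n" by (simp add: card_cartesian_product)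
    then show ?thesis unfolding power2_eq_square by (metis of_nat_mono of_nat_mult)
  qed
  have "expectation (\<lambda>\<omega>. (\<Sum>i\<in>{1..n}. \<Sum>j\<in>others i. remainder i j \<omega>)\<^sup>2)
      = (\<Sum>p\<in>P. \<Sum>p'\<in>P. expectation (\<lambda>\<omega>. R p \<omega> * R p' \<omega>))"
    unfolding eq using int by (simp add: Bochner_Integration.integral_sum Bochner_Integration.integrable_sum)
  also have "\<dots> \<le> real (card P) * (2 * (real m)\<^sup>2 * (9 * B))"
    by (rule sum_bounded_above[OF inner])
  also have "\<dots> \<le> (real n)\<^sup>2 * (2 * (real m)\<^sup>2 * (9 * B))"
    using B_nonneg by (intro mult_right_mono cardP) auto
  \<comment> \<open>The count yields the factor \<open>2 * 9 = 18\<close>, rounded up to the square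
    25 because a root is taken later.\<close>
  also have "\<dots> \<le> (5 * real n * real m)\<^sup>2 * B"
  proof -
    have "18 * ((real n)\<^sup>2 * (real m)\<^sup>2 * B) \<le> 25 * ((real n)\<^sup>2 * (real m)\<^sup>2 * B)"
      using B_nonneg by (intro mult_right_mono) auto
    then show ?thesis by (simp add: power_mult_distrib mult_ac)
  qed
  finally show "expectation (\<lambda>\<omega>. (\<Sum>i\<in>{1..n}. \<Sum>j\<in>others i. remainder i j \<omega>)\<^sup>2) \<le> (5 * real n * real m)\<^sup>2 * B" .
qed

end

section \<open>Linear part and approximation error\<close>

lemma U_stat_integrable: "integrable M (U_stat \<phi> W n)"
  unfolding U_stat_def[abs_def]
  by (intro integrable_mult_right Bochner_Integration.integrable_sum kernel_integrable) auto

lemma proj_integrable: "i \<in> {1..n} \<Longrightarrow> integrable M (proj i)"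
  using integrable_cong_AE[OF proj_measurable H_W_measurable proj_AE] H_integrable by simp

lemma proj_sum_AE: "AE \<omega> in M. \<forall>i\<in>{1..n}. proj i \<omega> = H i (W i \<omega>)"
  by (rule AE_finite_allI) (auto intro: proj_AE)

lemma kernel_sum_decomposition:
  "(\<Sum>i\<in>{1..n}. \<Sum>j\<in>{1..n} - {i}. \<phi> (W i \<omega>) (W j \<omega>))
    = (\<Sum>i\<in>{1..n}. \<Sum>j\<in>cluster n g (g i) - {i}. \<phi> (W i \<omega>) (W j \<omega>))
      + (\<Sum>i\<in>{1..n}. \<Sum>j\<in>others i. remainder i j \<omega>)
      + 2 * (\<Sum>i\<in>{1..n}. (real n - real (size (g i))) * H i (W i \<omega>))"
proof -
  have 1: "(\<Sum>j\<in>{1..n} - {i}. \<phi> (W i \<omega>) (W j \<omega>))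
      = (\<Sum>j\<in>cluster n g (g i) - {i}. \<phi> (W i \<omega>) (W j \<omega>)) + (\<Sum>j\<in>others i. \<phi> (W i \<omega>) (W j \<omega>))" for i
  proof -
    have "{1..n} - {i} = (cluster n g (g i) - {i}) \<union> others i"
      by (auto simp: cluster_def others_def)
    then show ?thesis
      by (simp add: sum.union_disjoint others_def cluster_def disjoint_iff)
  qed
  have 2: "\<phi> (W i \<omega>) (W j \<omega>) = remainder i j \<omega> + h j (W i \<omega>) + h i (W j \<omega>)" for i j
    by (simp add: remainder_def)
  \<comment> \<open>If \<open>others i\<close> is empty, both sides are 0.\<close>
  have 3: "(\<Sum>j\<in>others i. h j (W i \<omega>)) = (real n - real (size (g i))) * H i (W i \<omega>)" for i
    by (cases "others i = {}") (auto simp: H_def card_others[symmetric])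
  \<comment> \<open>Lying in different clusters is a symmetric relation, so the two projection sums
    coincide; this is the origin of the factor 2.\<close>
  have 4: "(\<Sum>i\<in>{1..n}. \<Sum>j\<in>others i. h i (W j \<omega>)) = (\<Sum>i\<in>{1..n}. \<Sum>j\<in>others i. h j (W i \<omega>))"
  proof -
    have "(\<Sum>i\<in>{1..n}. \<Sum>j | j \<in> {1..n} \<and> g j \<noteq> g i. h i (W j \<omega>))
        = (\<Sum>j\<in>{1..n}. \<Sum>i | i \<in> {1..n} \<and> g j \<noteq> g i. h i (W j \<omega>))"
      by (rule sum.swap_restrict) auto
    moreover have "{j. j \<in> {1..n} \<and> g j \<noteq> g i} = others i" "{j. j \<in> {1..n} \<and> g i \<noteq> g j} = others i" for i
      by (auto simp: others_def)
    ultimately show ?thesis by simp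
  qed
  have "(\<Sum>i\<in>{1..n}. \<Sum>j\<in>others i. \<phi> (W i \<omega>) (W j \<omega>))
      = (\<Sum>i\<in>{1..n}. \<Sum>j\<in>others i. remainder i j \<omega>)
        + 2 * (\<Sum>i\<in>{1..n}. (real n - real (size (g i))) * H i (W i \<omega>))"
    unfolding 2 sum.distrib 4 3 by simp
  then show ?thesis
    unfolding 1 sum.distrib by simp
qed

text \<open>Written through the cluster totals, to be a sum of independent terms; it agrees almost
  everywhere with the expression in \<open>avg_proj\<close>.\<close>

definition linear_part :: "'w \<Rightarrow> real" where
  "linear_part \<omega> = 2 / real n * (\<Sum>k\<in>{1..G}. Y k \<omega>)"

lemma linear_part_eq: "linear_part \<omega> = 2 / real n * (\<Sum>i\<in>{1..n}. H i (W i \<omega>))"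
  unfolding linear_part_def Y_def sum_by_cluster ..

lemma linear_part_AE:
  "AE \<omega> in M. 2 / real n * (\<Sum>i\<in>{1..n}. proj i \<omega>) = linear_part \<omega>"
  using proj_sum_AE by eventually_elim (simp add: linear_part_eq)

lemma linear_part_integrable: "integrable M linear_part"
  unfolding linear_part_def[abs_def]
  by (intro integrable_mult_right Bochner_Integration.integrable_sum Y_integrable)

text \<open>The projections carry weight \<open>n - size\<close> in the kernel sum but
  \<open>n - 1\<close> after normalising the linear part. The mismatch \<open>size - 1\<close> is
  the third error term, beside within-cluster pairs and remainders.\<close>

lemma U_stat_minus_linear_part:
  assumes n: "n \<ge> 2"
  shows "U_stat \<phi> W n \<omega> - linear_part \<omega> = 1 / (real n * (real n - 1)) *
    ((\<Sum>i\<in>{1..n}. \<Sum>j\<in>cluster n g (g i) - {i}. \<phi> (W i \<omega>) (W j \<omega>))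
      + (\<Sum>i\<in>{1..n}. \<Sum>j\<in>others i. remainder i j \<omega>)
      - 2 * (\<Sum>i\<in>{1..n}. (real (size (g i)) - 1) * H i (W i \<omega>)))"
proof -
  have n1: "real n - 1 \<noteq> 0" "real n \<noteq> 0" using n by auto
  have "linear_part \<omega> = 1 / (real n * (real n - 1)) * (2 * (\<Sum>i\<in>{1..n}. (real n - 1) * H i (W i \<omega>)))"
    using n1 by (simp add: linear_part_eq sum_distrib_left[symmetric])
  moreover have "(\<Sum>i\<in>{1..n}. (real n - 1) * H i (W i \<omega>))
     = (\<Sum>i\<in>{1..n}. (real n - real (size (g i))) * H i (W i \<omega>))
       + (\<Sum>i\<in>{1..n}. (real (size (g i)) - 1) * H i (W i \<omega>))"
    by (simp add: algebra_simps flip: sum.distrib)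
  ultimately have lin: "linear_part \<omega> = 1 / (real n * (real n - 1)) *
     (2 * ((\<Sum>i\<in>{1..n}. (real n - real (size (g i))) * H i (W i \<omega>))
       + (\<Sum>i\<in>{1..n}. (real (size (g i)) - 1) * H i (W i \<omega>))))"
    by (simp only:)
  show ?thesis
    unfolding U_stat_def kernel_sum_decomposition lin right_diff_distrib[symmetric] by simp
qed

lemma Y_sum_square:
  assumes sq: "\<And>k. k \<in> {1..G} \<Longrightarrow> integrable M (\<lambda>\<omega>. (Y k \<omega>)\<^sup>2)"
  shows "integrable M (\<lambda>\<omega>. (\<Sum>k\<in>{1..G}. Y k \<omega>)\<^sup>2)"
    and "expectation (\<lambda>\<omega>. (\<Sum>k\<in>{1..G}. Y k \<omega>)\<^sup>2) = (\<Sum>k\<in>{1..G}. expectation (\<lambda>\<omega>. (Y k \<omega>)\<^sup>2))"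
proof -
  have prod: "integrable M (\<lambda>\<omega>. Y k \<omega> * Y l \<omega>)"
    "expectation (\<lambda>\<omega>. Y k \<omega> * Y l \<omega>) = (if k = l then expectation (\<lambda>\<omega>. (Y k \<omega>)\<^sup>2) else 0)"
    if k: "k \<in> {1..G}" and l: "l \<in> {1..G}" for k l
  proof -
    have "integrable M (\<lambda>\<omega>. Y k \<omega> * Y l \<omega>)
      \<and> expectation (\<lambda>\<omega>. Y k \<omega> * Y l \<omega>) = (if k = l then expectation (\<lambda>\<omega>. (Y k \<omega>)\<^sup>2) else 0)"
    proof (cases "k = l")
      case True
      then show ?thesis using sq[OF k] by (simp add: power2_eq_square)
    next
      case False
      have "indep_vars (\<lambda>_. borel) Y {k, l}"
        by (rule indep_vars_subset[OF Y_indep]) (use k l in auto)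
      then show ?thesis
        using indep_vars_integrable[of "{k, l}" Y] indep_vars_lebesgue_integral[of "{k, l}" Y]
          Y_integrable False by (simp add: Y_expectation_zero)
    qed
    then show "integrable M (\<lambda>\<omega>. Y k \<omega> * Y l \<omega>)"
      "expectation (\<lambda>\<omega>. Y k \<omega> * Y l \<omega>) = (if k = l then expectation (\<lambda>\<omega>. (Y k \<omega>)\<^sup>2) else 0)"
      by auto
  qed
  have eq: "(\<Sum>k\<in>{1..G}. Y k \<omega>)\<^sup>2 = (\<Sum>k\<in>{1..G}. \<Sum>l\<in>{1..G}. Y k \<omega> * Y l \<omega>)" for \<omega>
    by (simp add: power2_eq_square sum_product)
  show "integrable M (\<lambda>\<omega>. (\<Sum>k\<in>{1..G}. Y k \<omega>)\<^sup>2)"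
    unfolding eq by (intro Bochner_Integration.integrable_sum prod)
  have "expectation (\<lambda>\<omega>. (\<Sum>k\<in>{1..G}. Y k \<omega>)\<^sup>2)
      = (\<Sum>k\<in>{1..G}. \<Sum>l\<in>{1..G}. expectation (\<lambda>\<omega>. Y k \<omega> * Y l \<omega>))"
    unfolding eq using prod(1)
    by (simp add: Bochner_Integration.integral_sum Bochner_Integration.integrable_sum del: atLeastAtMost_iff)
  also have "\<dots> = (\<Sum>k\<in>{1..G}. \<Sum>l\<in>{1..G}. if k = l then expectation (\<lambda>\<omega>. (Y k \<omega>)\<^sup>2) else 0)"
    by (intro sum.cong refl prod(2))
  also have "\<dots> = (\<Sum>k\<in>{1..G}. expectation (\<lambda>\<omega>. (Y k \<omega>)\<^sup>2))"
    by simp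
  finally show "expectation (\<lambda>\<omega>. (\<Sum>k\<in>{1..G}. Y k \<omega>)\<^sup>2) = (\<Sum>k\<in>{1..G}. expectation (\<lambda>\<omega>. (Y k \<omega>)\<^sup>2))" .
qed

text \<open>By independence, \<open>sigma_U\<close> squared is thus the variance of
  \<open>sqrt n\<close> times \<open>linear_part\<close>.\<close>

lemma sigma_U_eq:
  "sigma_U M S \<phi> W n g G = sqrt (4 / real n * (\<Sum>k\<in>{1..G}. expectation (\<lambda>\<omega>. (Y k \<omega>)\<^sup>2)))"
proof -
  have "expectation (\<lambda>\<omega>. (\<Sum>i\<in>cluster n g k. proj i \<omega>)\<^sup>2) = expectation (\<lambda>\<omega>. (Y k \<omega>)\<^sup>2)" for k
  proof (rule integral_cong_AE)
    show "(\<lambda>\<omega>. (\<Sum>i\<in>cluster n g k. proj i \<omega>)\<^sup>2) \<in> borel_measurable M"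
      using proj_measurable by measurable
    show "(\<lambda>\<omega>. (Y k \<omega>)\<^sup>2) \<in> borel_measurable M"
      using Y_measurable by measurable
    show "AE \<omega> in M. (\<Sum>i\<in>cluster n g k. proj i \<omega>)\<^sup>2 = (Y k \<omega>)\<^sup>2"
      using proj_sum_AE
    proof eventually_elim
      case (elim \<omega>)
      then have "(\<Sum>i\<in>cluster n g k. proj i \<omega>) = Y k \<omega>"
        unfolding Y_def by (intro sum.cong refl) (use clusterD(1) in blast)
      then show ?case by simp
    qed
  qed
  then show ?thesis unfolding sigma_U_def by simp
qed

context
  fixes B :: real
  assumes B: "\<And>i j. i \<in> {1..n} \<Longrightarrow> j \<in> {1..n} \<Longrightarrow> expectation (\<lambda>\<omega>. (\<phi> (W i \<omega>) (W j \<omega>))\<^sup>2) \<le> B"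
begin

text \<open>Within-cluster pairs are not centred, so at most \<open>n * m\<close> of them are
  counted in absolute value. The remainders use their second moment, and the weight mismatch is at
  most \<open>m\<close> per unit. All three are of order \<open>n * m\<close> before
  normalisation.\<close>

lemma U_stat_minus_linear_part_bound:
  assumes n: "n \<ge> 2"
  shows "expectation (\<lambda>\<omega>. \<bar>U_stat \<phi> W n \<omega> - linear_part \<omega>\<bar>) \<le> 16 * sqrt B * (real m / real n)"
proof -
  note B0 = B_nonneg[OF B]
  define A where "A \<omega> = (\<Sum>i\<in>{1..n}. \<Sum>j\<in>cluster n g (g i) - {i}. \<bar>\<phi> (W i \<omega>) (W j \<omega>)\<bar>)" for \<omega>
  define R where "R \<omega> = (\<Sum>i\<in>{1..n}. \<Sum>j\<in>others i. remainder i j \<omega>)" for \<omega>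
  define L where "L \<omega> = (\<Sum>i\<in>{1..n}. (real (size (g i)) - 1) * \<bar>H i (W i \<omega>)\<bar>)" for \<omega>
  let ?c = "1 / (real n * (real n - 1))"
  have c: "?c \<ge> 0" using n by simp
  have size1: "real (size (g i)) - 1 \<ge> 0" if "i \<in> {1..n}" for i
    using size_pos[of "g i"] imageI[OF that, of g] unfolding g_image by simp
  have Rm: "R \<in> borel_measurable M"
    unfolding R_def[abs_def] using remainder_measurable othersD(1)
    by (intro borel_measurable_sum) blast
  note R_sq = remainder_sum_square[OF B, folded R_def]
  have iA: "integrable M A"
    unfolding A_def[abs_def]
    by (intro Bochner_Integration.integrable_sum integrable_abs kernel_integrable) (auto simp: cluster_def)
  have iR: "integrable M R"
    by (rule square_integrable_imp_integrable[OF Rm R_sq(1)])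
  have iL: "integrable M L"
    unfolding L_def[abs_def]
    by (intro Bochner_Integration.integrable_sum integrable_mult_right integrable_abs H_integrable)
  have EA: "expectation A \<le> real n * (real m * sqrt B)"
  proof -
    have "expectation A = (\<Sum>i\<in>{1..n}. \<Sum>j\<in>cluster n g (g i) - {i}. expectation (\<lambda>\<omega>. \<bar>\<phi> (W i \<omega>) (W j \<omega>)\<bar>))"
    proof -
      have int: "integrable M (\<lambda>\<omega>. \<bar>\<phi> (W i \<omega>) (W j \<omega>)\<bar>)"
        if "i \<in> {1..n}" "j \<in> cluster n g (g i) - {i}" for i j
        using that by (intro integrable_abs kernel_integrable) (auto simp: cluster_def)
      have "expectation A = (\<Sum>i\<in>{1..n}. expectation (\<lambda>\<omega>. \<Sum>j\<in>cluster n g (g i) - {i}. \<bar>\<phi> (W i \<omega>) (W j \<omega>)\<bar>))"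
        unfolding A_def[abs_def]
        by (rule Bochner_Integration.integral_sum) (intro Bochner_Integration.integrable_sum int)
      also have "\<dots> = (\<Sum>i\<in>{1..n}. \<Sum>j\<in>cluster n g (g i) - {i}. expectation (\<lambda>\<omega>. \<bar>\<phi> (W i \<omega>) (W j \<omega>)\<bar>))"
        by (intro sum.cong refl Bochner_Integration.integral_sum int)
      finally show ?thesis .
    qed
    also have "\<dots> \<le> (\<Sum>i\<in>{1..n}. real m * sqrt B)"
    proof (rule sum_mono)
      fix i assume i: "i \<in> {1..n}"
      have "(\<Sum>j\<in>cluster n g (g i) - {i}. expectation (\<lambda>\<omega>. \<bar>\<phi> (W i \<omega>) (W j \<omega>)\<bar>))
          \<le> real (card (cluster n g (g i) - {i})) * sqrt B"
      proof (rule sum_bounded_above)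
        fix j assume "j \<in> cluster n g (g i) - {i}"
        then have j: "j \<in> {1..n}" by (auto simp: cluster_def)
        show "expectation (\<lambda>\<omega>. \<bar>\<phi> (W i \<omega>) (W j \<omega>)\<bar>) \<le> sqrt B"
          by (rule expectation_abs_le_sqrt[OF kernel_W_measurable kernel_square_integrable B]) fact+
      qed
      also have "\<dots> \<le> real m * sqrt B"
      proof (intro mult_right_mono of_nat_mono)
        have "card (cluster n g (g i) - {i}) \<le> size (g i)"
          unfolding cluster_size_def by (rule card_mono) auto
        then show "card (cluster n g (g i) - {i}) \<le> m" using size_le_max[OF i] by simp
      qed (use B0 in simp)
      finally show "(\<Sum>j\<in>cluster n g (g i) - {i}. expectation (\<lambda>\<omega>. \<bar>\<phi> (W i \<omega>) (W j \<omega>)\<bar>)) \<le> real m * sqrt B" .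
    qed
    finally show ?thesis by simp
  qed
  have ER: "expectation (\<lambda>\<omega>. \<bar>R \<omega>\<bar>) \<le> 5 * real n * real m * sqrt B"
    using expectation_abs_le_sqrt[OF Rm R_sq] by (simp add: real_sqrt_mult)
  have EL: "expectation L \<le> real n * (real m * sqrt B)"
  proof -
    have "expectation L = (\<Sum>i\<in>{1..n}. (real (size (g i)) - 1) * expectation (\<lambda>\<omega>. \<bar>H i (W i \<omega>)\<bar>))"
      unfolding L_def[abs_def] using H_integrable by simp
    also have "\<dots> \<le> (\<Sum>i\<in>{1..n}. real m * sqrt B)"
    proof (rule sum_mono)
      fix i assume i: "i \<in> {1..n}"
      have "real (size (g i)) \<le> real m" using size_le_max[OF i] by simp
      then have "real (size (g i)) - 1 \<le> real m" by linarith
      moreover have "expectation (\<lambda>\<omega>. \<bar>H i (W i \<omega>)\<bar>) \<le> sqrt B"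
        by (rule expectation_abs_le_sqrt[OF H_W_measurable[OF i] H_square[OF B i]])
      ultimately show "(real (size (g i)) - 1) * expectation (\<lambda>\<omega>. \<bar>H i (W i \<omega>)\<bar>) \<le> real m * sqrt B"
        using size1[OF i] by (intro mult_mono) auto
    qed
    finally show ?thesis by simp
  qed
  have "expectation (\<lambda>\<omega>. \<bar>U_stat \<phi> W n \<omega> - linear_part \<omega>\<bar>) \<le> expectation (\<lambda>\<omega>. ?c * (A \<omega> + \<bar>R \<omega>\<bar> + 2 * L \<omega>))"
  proof (rule integral_mono)
    show "integrable M (\<lambda>\<omega>. \<bar>U_stat \<phi> W n \<omega> - linear_part \<omega>\<bar>)"
      using U_stat_integrable linear_part_integrable by auto
    show "integrable M (\<lambda>\<omega>. ?c * (A \<omega> + \<bar>R \<omega>\<bar> + 2 * L \<omega>))"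
      using iA iR iL by auto
    fix \<omega>
    let ?a = "\<Sum>i\<in>{1..n}. \<Sum>j\<in>cluster n g (g i) - {i}. \<phi> (W i \<omega>) (W j \<omega>)"
    let ?l = "\<Sum>i\<in>{1..n}. (real (size (g i)) - 1) * H i (W i \<omega>)"
    have "\<bar>?a\<bar> \<le> A \<omega>"
      unfolding A_def by (rule order_trans[OF sum_abs]) (intro sum_mono sum_abs)
    moreover have "\<bar>?l\<bar> \<le> L \<omega>"
      unfolding L_def
    proof (rule order_trans[OF sum_abs], rule sum_mono)
      fix i assume "i \<in> {1..n}"
      from size1[OF this] show "\<bar>(real (size (g i)) - 1) * H i (W i \<omega>)\<bar> \<le> (real (size (g i)) - 1) * \<bar>H i (W i \<omega>)\<bar>"
        by (simp add: abs_mult)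
    qed
    ultimately have "\<bar>?a + R \<omega> - 2 * ?l\<bar> \<le> A \<omega> + \<bar>R \<omega>\<bar> + 2 * L \<omega>"
      by linarith
    then show "\<bar>U_stat \<phi> W n \<omega> - linear_part \<omega>\<bar> \<le> ?c * (A \<omega> + \<bar>R \<omega>\<bar> + 2 * L \<omega>)"
      unfolding U_stat_minus_linear_part[OF n] R_def[symmetric] abs_mult
      using c by (simp only: abs_of_nonneg mult_left_mono)
  qed
  also have "\<dots> = ?c * (expectation A + expectation (\<lambda>\<omega>. \<bar>R \<omega>\<bar>) + 2 * expectation L)"
    using iA iR iL by simp
  also have "\<dots> \<le> ?c * (real n * (real m * sqrt B) + 5 * real n * real m * sqrt B + 2 * (real n * (real m * sqrt B)))"
    by (rule mult_left_mono[OF _ c]) (use EA ER EL in linarith)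
  \<comment> \<open>\<open>8 = 1 + 5 + 2\<close>, from within-cluster pairs, remainders and weights;
    it doubles to 16 because \<open>1 / (n - 1) \<le> 2 / n\<close> for
    \<open>n \<ge> 2\<close>.\<close>
  also have "\<dots> = 8 * sqrt B * real m * (1 / (real n - 1))"
    using n by (simp add: field_simps)
  also have "\<dots> \<le> 8 * sqrt B * real m * (2 / real n)"
    using n B0 by (intro mult_left_mono) (auto simp: field_simps)
  finally show ?thesis by simp
qed

lemma linear_part_bound: "expectation (\<lambda>\<omega>. \<bar>linear_part \<omega>\<bar>) \<le> 2 * sqrt B * sqrt (real m / real n)"
proof -
  note B0 = B_nonneg[OF B]
  have n0: "real n > 0" using n_ge_1 by simp
  have sq: "integrable M (\<lambda>\<omega>. (\<Sum>k\<in>{1..G}. Y k \<omega>)\<^sup>2)"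
    "expectation (\<lambda>\<omega>. (\<Sum>k\<in>{1..G}. Y k \<omega>)\<^sup>2) = (\<Sum>k\<in>{1..G}. expectation (\<lambda>\<omega>. (Y k \<omega>)\<^sup>2))"
    using Y_square(1)[OF B] by (intro Y_sum_square; blast)+
  have "expectation (\<lambda>\<omega>. (\<Sum>k\<in>{1..G}. Y k \<omega>)\<^sup>2) \<le> (\<Sum>k\<in>{1..G}. (real (size k))\<^sup>2 * B)"
    unfolding sq(2) by (intro sum_mono Y_square(2)[OF B])
  \<comment> \<open>One factor of the squared size is bounded by \<open>m\<close>; the remaining
    sizes add up to \<open>n\<close>.\<close>
  also have "\<dots> \<le> (\<Sum>k\<in>{1..G}. real m * B * real (size k))"
    using size_le_max' B0 by (intro sum_mono) (auto simp: power2_eq_square mult_ac intro!: mult_left_mono)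
  also have "\<dots> = real m * B * (\<Sum>k\<in>{1..G}. \<Sum>i\<in>cluster n g k. 1)"
    by (simp add: cluster_size_def sum_distrib_left)
  also have "\<dots> = real m * B * real n"
    unfolding sum_by_cluster by simp
  finally have E: "expectation (\<lambda>\<omega>. (\<Sum>k\<in>{1..G}. Y k \<omega>)\<^sup>2) \<le> real m * B * real n" .
  have "expectation (\<lambda>\<omega>. \<bar>linear_part \<omega>\<bar>) = 2 / real n * expectation (\<lambda>\<omega>. \<bar>\<Sum>k\<in>{1..G}. Y k \<omega>\<bar>)"
    unfolding linear_part_def by (simp add: abs_mult)
  also have "\<dots> \<le> 2 / real n * sqrt (real m * B * real n)"
    using n0 Y_measurable
    by (intro mult_left_mono expectation_abs_le_sqrt[OF _ sq(1) E] borel_measurable_sum) auto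
  also have "sqrt (real m * B * real n) = sqrt (B * (real m / real n) * (real n)\<^sup>2)"
    using n0 by (simp add: power2_eq_square)
  also have "\<dots> = sqrt B * sqrt (real m / real n) * real n"
    unfolding real_sqrt_mult by simp
  also have "2 / real n * (sqrt B * sqrt (real m / real n) * real n) = 2 * sqrt B * sqrt (real m / real n)"
    using n0 by simp
  finally show ?thesis .
qed

lemma U_stat_bound:
  assumes n: "n \<ge> 2"
  shows "expectation (\<lambda>\<omega>. \<bar>U_stat \<phi> W n \<omega>\<bar>) \<le> 18 * sqrt B * sqrt (real m / real n)"
proof -
  have le1: "real m / real n \<le> 1" "0 \<le> real m / real n" using m_le_n n by auto
  have "real m / real n \<le> sqrt (real m / real n)"
    using mult_right_mono[OF le1] by (intro real_le_rsqrt) (simp add: power2_eq_square)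
  then have *: "16 * sqrt B * (real m / real n) \<le> 16 * sqrt B * sqrt (real m / real n)"
    using B_nonneg[OF B] by (intro mult_left_mono) auto
  have "expectation (\<lambda>\<omega>. \<bar>U_stat \<phi> W n \<omega>\<bar>)
      \<le> expectation (\<lambda>\<omega>. \<bar>U_stat \<phi> W n \<omega> - linear_part \<omega>\<bar> + \<bar>linear_part \<omega>\<bar>)"
    using U_stat_integrable linear_part_integrable by (intro integral_mono) auto
  also have "\<dots> \<le> 16 * sqrt B * (real m / real n) + 2 * sqrt B * sqrt (real m / real n)"
    using U_stat_integrable linear_part_integrable U_stat_minus_linear_part_bound[OF n] linear_part_bound
    by simp
  finally show ?thesis using * by simp
qed

end

section \<open>Lindeberg condition and standardised characteristic function\<close>

text \<open>Jensen controls the soft threshold of the normalised total \<open>Y k / size k\<close>.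
  Undoing the normalisation costs \<open>size k powr r\<close>, and trading the power
  \<open>r\<close> for the square gains \<open>a powr (2 - r)\<close>.\<close>

lemma truncated_Y_square_sum:
  fixes r K \<tau> a :: real
  assumes r: "r \<ge> 2" and K: "K \<ge> 0" and a: "a > 0" "2 * K * real m \<le> a"
    and int: "\<And>i j. i \<in> {1..n} \<Longrightarrow> j \<in> {1..n} \<Longrightarrow>
      integrable M (\<lambda>\<omega>. max (\<bar>\<phi> (W i \<omega>) (W j \<omega>)\<bar> - K) 0 powr r)"
    and le: "\<And>i j. i \<in> {1..n} \<Longrightarrow> j \<in> {1..n} \<Longrightarrow>
      expectation (\<lambda>\<omega>. max (\<bar>\<phi> (W i \<omega>) (W j \<omega>)\<bar> - K) 0 powr r) \<le> \<tau>"
  shows "(\<Sum>k\<in>{1..G}. expectation (\<lambda>\<omega>. (Y k \<omega>)\<^sup>2 * of_bool (\<bar>Y k \<omega>\<bar> > a)))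
    \<le> a powr (2 - r) * 2 powr r * \<tau> * (\<Sum>k\<in>{1..G}. real (size k) powr r)"
proof -
  define q where "q x = max (\<bar>x\<bar> - K) 0 powr r" for x :: real
  have q: "convex_on UNIV q" "q \<in> borel_measurable borel" "\<And>x. 0 \<le> q x" "q 0 = 0"
    unfolding q_def[abs_def] using r K by (auto intro!: convex_on_soft_threshold_powr)
  have "expectation (\<lambda>\<omega>. (Y k \<omega>)\<^sup>2 * of_bool (\<bar>Y k \<omega>\<bar> > a))
      \<le> a powr (2 - r) * 2 powr r * \<tau> * real (size k) powr r" if k: "k \<in> {1..G}" for k
  proof -
    let ?s = "real (size k)"
    have s: "?s \<ge> 1" "?s \<le> real m" using size_pos[OF k] size_le_max'[OF k] by auto
    let ?c = "a powr (2 - r) * 2 powr r * ?s powr r"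
    have point: "y\<^sup>2 * of_bool (\<bar>y\<bar> > a) \<le> ?c * q (y / ?s)" for y :: real
    proof (cases "\<bar>y\<bar> > a")
      case True
      have y0: "\<bar>y\<bar> > 0" using a True by simp
      \<comment> \<open>Since \<open>?s \<le> m\<close>, a total above \<open>a\<close> has
        normalised value at least \<open>2 * K\<close>, so subtracting \<open>K\<close> removes at
        most half of it.\<close>
      have "K * ?s \<le> K * real m" using s K by (intro mult_left_mono)
      then have "2 * (K * ?s) \<le> \<bar>y\<bar>" using a True by linarith
      then have zK: "2 * K \<le> \<bar>y\<bar> / ?s"
        using s by (simp add: field_simps)
      have "y\<^sup>2 = \<bar>y\<bar> powr (2 - r) * \<bar>y\<bar> powr r"
        using y0 by (simp flip: powr_add)
      \<comment> \<open>The exponent \<open>2 - r\<close> is not positive, so the power decreases in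
        its base.\<close>
      also have "\<dots> \<le> a powr (2 - r) * \<bar>y\<bar> powr r"
        using a True r by (intro mult_right_mono powr_mono2') auto
      finally have y2: "y\<^sup>2 \<le> a powr (2 - r) * \<bar>y\<bar> powr r" .
      have "\<bar>y\<bar> powr r = ?s powr r * (\<bar>y\<bar> / ?s) powr r"
        using s by (simp flip: powr_mult)
      also have "\<dots> \<le> ?s powr r * (2 * max (\<bar>y / ?s\<bar> - K) 0) powr r"
        using zK s r by (intro mult_left_mono powr_mono2) (auto simp: max_def)
      also have "\<dots> = ?s powr r * (2 powr r * q (y / ?s))"
        unfolding q_def by (subst powr_mult) auto
      finally have "a powr (2 - r) * \<bar>y\<bar> powr r \<le> a powr (2 - r) * (?s powr r * (2 powr r * q (y / ?s)))"
        by (rule mult_left_mono) simp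
      with y2 show ?thesis using True by (simp add: mult_ac)
    next
      case False
      then show ?thesis using q(3) by simp
    qed
    note Yq = expectation_convex_Y_le[OF q int[folded q_def] le[folded q_def] k]
    have "expectation (\<lambda>\<omega>. (Y k \<omega>)\<^sup>2 * of_bool (\<bar>Y k \<omega>\<bar> > a)) \<le> expectation (\<lambda>\<omega>. ?c * q (Y k \<omega> / ?s))"
    proof (rule integral_mono')
      show "integrable M (\<lambda>\<omega>. ?c * q (Y k \<omega> / ?s))"
        by (intro integrable_mult_right Yq(1))
      show "0 \<le> ?c * q (Y k \<omega> / ?s)" for \<omega>
        using q(3) by simp
    qed (rule point)
    also have "\<dots> \<le> ?c * \<tau>"
      unfolding integral_mult_right_zero using Yq(2) by (intro mult_left_mono) auto
    finally show ?thesis by (simp add: mult_ac)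
  qed
  then show ?thesis
    unfolding sum_distrib_left by (rule sum_mono)
qed

text \<open>\<open>lindeberg_char_bound\<close> treats the normalised cluster totals; the last
  summand is the L1 distance between the U-statistic and its linear part, scaled by
  \<open>sqrt n / \<sigma>\<close>.\<close>

lemma standardised_char_bound:
  fixes B \<sigma> \<epsilon> t L :: real
  defines "\<sigma> \<equiv> sigma_U M S \<phi> W n g G"
  assumes B: "\<And>i j. i \<in> {1..n} \<Longrightarrow> j \<in> {1..n} \<Longrightarrow> expectation (\<lambda>\<omega>. (\<phi> (W i \<omega>) (W j \<omega>))\<^sup>2) \<le> B"
    and n: "n \<ge> 2" and \<sigma>: "\<sigma> > 0" and \<epsilon>: "\<epsilon> > 0"
    and L: "4 / (real n * \<sigma>\<^sup>2) * (\<Sum>k\<in>{1..G}. expectation (\<lambda>\<omega>. (Y k \<omega>)\<^sup>2 *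
      of_bool (\<bar>Y k \<omega>\<bar> > \<epsilon> * \<sigma> / 2 * sqrt (real n)))) \<le> L"
  shows "cmod (char (distr M borel (\<lambda>\<omega>. sqrt (real n) * U_stat \<phi> W n \<omega> / \<sigma>)) t - exp (- (t\<^sup>2) / 2))
    \<le> \<bar>t\<bar> ^ 3 * \<epsilon> / 6 + t\<^sup>2 * L + t ^ 4 / 4 * (\<epsilon>\<^sup>2 + L) + \<bar>t\<bar> * (16 * sqrt B * (real m / sqrt (real n)) / \<sigma>)"
proof -
  define s where "s = sqrt (real n)"
  have s: "s > 0" "s\<^sup>2 = real n" "s * s = real n" using n by (auto simp: s_def)
  \<comment> \<open>Scaled so that the variances sum to exactly 1 and the total is
    \<open>sqrt n / \<sigma>\<close> times \<open>linear_part\<close>.\<close>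
  define X where "X k \<omega> = 2 / (s * \<sigma>) * Y k \<omega>" for k \<omega>
  have Xsq: "(X k \<omega>)\<^sup>2 = 4 / (real n * \<sigma>\<^sup>2) * (Y k \<omega>)\<^sup>2" for k \<omega>
    unfolding X_def using s by (simp add: power_mult_distrib power_divide)
  have Xgt: "\<bar>X k \<omega>\<bar> > \<epsilon> \<longleftrightarrow> \<bar>Y k \<omega>\<bar> > \<epsilon> * \<sigma> / 2 * sqrt (real n)" for k \<omega>
    unfolding X_def s_def[symmetric] using s \<sigma> by (simp add: abs_mult field_simps)
  note Ysq = Y_square(1)[OF B]
  have \<sigma>2: "\<sigma>\<^sup>2 = 4 / real n * (\<Sum>k\<in>{1..G}. expectation (\<lambda>\<omega>. (Y k \<omega>)\<^sup>2))"
    unfolding \<sigma>_def sigma_U_eq by (intro real_sqrt_pow2 mult_nonneg_nonneg sum_nonneg) auto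
  have 1: "cmod (char (distr M borel (\<lambda>\<omega>. \<Sum>k\<in>{1..G}. X k \<omega>)) t - exp (- (t\<^sup>2) / 2))
    \<le> \<bar>t\<bar> ^ 3 * \<epsilon> / 6 + t\<^sup>2 * L + t ^ 4 / 4 * (\<epsilon>\<^sup>2 + L)"
  proof (rule lindeberg_char_bound)
    show "indep_vars (\<lambda>_. borel) X {1..G}"
      unfolding X_def[abs_def] by (rule indep_vars_compose2[OF Y_indep]) simp
    show "integrable M (\<lambda>\<omega>. (X k \<omega>)\<^sup>2)" if "k \<in> {1..G}" for k
      unfolding Xsq by (intro integrable_mult_right Ysq that)
    show "expectation (X k) = 0" for k
      unfolding X_def by (simp add: Y_expectation_zero)
    show "(\<Sum>k\<in>{1..G}. expectation (\<lambda>\<omega>. (X k \<omega>)\<^sup>2)) = 1"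
    proof -
      have "(\<Sum>k\<in>{1..G}. expectation (\<lambda>\<omega>. (X k \<omega>)\<^sup>2)) = \<sigma>\<^sup>2 / \<sigma>\<^sup>2"
        unfolding Xsq integral_mult_right_zero sum_distrib_left[symmetric] by (subst (2) \<sigma>2) simp
      then show ?thesis using \<sigma> by simp
    qed
    have "(\<Sum>k\<in>{1..G}. expectation (\<lambda>\<omega>. (X k \<omega>)\<^sup>2 * of_bool (\<bar>X k \<omega>\<bar> > \<epsilon>)))
        = 4 / (real n * \<sigma>\<^sup>2) * (\<Sum>k\<in>{1..G}. expectation (\<lambda>\<omega>. (Y k \<omega>)\<^sup>2 *
      of_bool (\<bar>Y k \<omega>\<bar> > \<epsilon> * \<sigma> / 2 * sqrt (real n))))"
      unfolding Xsq Xgt mult.assoc integral_mult_right_zero sum_distrib_left ..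
    then show "(\<Sum>k\<in>{1..G}. expectation (\<lambda>\<omega>. (X k \<omega>)\<^sup>2 * of_bool (\<bar>X k \<omega>\<bar> > \<epsilon>))) \<le> L"
      using L by simp
  qed (use \<epsilon> in auto)
  have Xsum: "(\<Sum>k\<in>{1..G}. X k \<omega>) = s / \<sigma> * linear_part \<omega>" for \<omega>
    unfolding X_def linear_part_def sum_distrib_left[symmetric] s(3)[symmetric] using s(1) by simp
  have diff: "s * U_stat \<phi> W n \<omega> / \<sigma> - (\<Sum>k\<in>{1..G}. X k \<omega>) = s / \<sigma> * (U_stat \<phi> W n \<omega> - linear_part \<omega>)" for \<omega>
    unfolding Xsum by (simp add: algebra_simps)
  have "cmod (char (distr M borel (\<lambda>\<omega>. s * U_stat \<phi> W n \<omega> / \<sigma>)) t - char (distr M borel (\<lambda>\<omega>. \<Sum>k\<in>{1..G}. X k \<omega>)) t)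
    \<le> \<bar>t\<bar> * expectation (\<lambda>\<omega>. \<bar>s * U_stat \<phi> W n \<omega> / \<sigma> - (\<Sum>k\<in>{1..G}. X k \<omega>)\<bar>)"
  proof (rule char_distr_diff_le)
    show "(\<lambda>\<omega>. s * U_stat \<phi> W n \<omega> / \<sigma>) \<in> borel_measurable M"
      using U_stat_integrable by simp
    show "(\<lambda>\<omega>. \<Sum>k\<in>{1..G}. X k \<omega>) \<in> borel_measurable M"
      unfolding Xsum using linear_part_integrable by simp
    show "integrable M (\<lambda>\<omega>. s * U_stat \<phi> W n \<omega> / \<sigma> - (\<Sum>k\<in>{1..G}. X k \<omega>))"
      unfolding diff using U_stat_integrable linear_part_integrable by simp
  qed
  also have "\<dots> = \<bar>t\<bar> * (s / \<sigma> * expectation (\<lambda>\<omega>. \<bar>U_stat \<phi> W n \<omega> - linear_part \<omega>\<bar>))"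
    unfolding diff abs_mult using s \<sigma> by simp
  also have "\<dots> \<le> \<bar>t\<bar> * (s / \<sigma> * (16 * sqrt B * (real m / real n)))"
    using s \<sigma> by (intro mult_left_mono U_stat_minus_linear_part_bound B n) auto
  also have "s / \<sigma> * (16 * sqrt B * (real m / real n)) = 16 * sqrt B * (real m / s) / \<sigma>"
    unfolding s(3)[symmetric] using s(1) by (simp add: mult_ac)
  finally have 2: "cmod (char (distr M borel (\<lambda>\<omega>. s * U_stat \<phi> W n \<omega> / \<sigma>)) t - char (distr M borel (\<lambda>\<omega>. \<Sum>k\<in>{1..G}. X k \<omega>)) t)
    \<le> \<bar>t\<bar> * (16 * sqrt B * (real m / s) / \<sigma>)" .
  show ?thesis
    using norm_triangle_ineq[of "char (distr M borel (\<lambda>\<omega>. s * U_stat \<phi> W n \<omega> / \<sigma>)) t - char (distr M borel (\<lambda>\<omega>. \<Sum>k\<in>{1..G}. X k \<omega>)) t"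
        "char (distr M borel (\<lambda>\<omega>. \<Sum>k\<in>{1..G}. X k \<omega>)) t - exp (- (t\<^sup>2) / 2)"] 1 2
    unfolding s_def[symmetric] by simp
qed

end

section \<open>Asymptotics\<close>

theorem theorem1:
  fixes M :: "nat \<Rightarrow> 'w measure"
    and S :: "'a measure"
    and W :: "nat \<Rightarrow> nat \<Rightarrow> 'w \<Rightarrow> 'a"
    and g :: "nat \<Rightarrow> nat \<Rightarrow> nat"
    and G :: "nat \<Rightarrow> nat"
    and \<phi> :: "'a \<Rightarrow> 'a \<Rightarrow> real"
    and r C :: real
  assumes S: "standard_borel S"
    and M: "\<And>n. n \<ge> 1 \<Longrightarrow> prob_space (M n)"
    and W: "\<And>n i. n \<ge> 1 \<Longrightarrow> i \<in> {1..n} \<Longrightarrow> W n i \<in> measurable (M n) S"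
    and clusters: "\<And>n. n \<ge> 1 \<Longrightarrow> g n ` {1..n} = {1..G n}"
    and phi_measurable: "(\<lambda>(x, y). \<phi> x y) \<in> borel_measurable (S \<Otimes>\<^sub>M S)"
    and phi_symmetric: "\<And>x y. x \<in> space S \<Longrightarrow> y \<in> space S \<Longrightarrow> \<phi> x y = \<phi> y x"
    and phi_centred: "\<And>n i j. n \<ge> 1 \<Longrightarrow> i \<in> {1..n} \<Longrightarrow> j \<in> {1..n} \<Longrightarrow> g n i \<noteq> g n j \<Longrightarrow>
           has_bochner_integral (M n) (\<lambda>\<omega>. \<phi> (W n i \<omega>) (W n j \<omega>)) 0"
    and r: "2 \<le> r"
    and indep: "\<And>n. n \<ge> 1 \<Longrightarrow> indep_across_clusters (M n) S (W n) n (g n) (G n)"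
    and cluster_sum: "\<And>n. n \<ge> 1 \<Longrightarrow>
           (\<Sum>k\<in>{1..G n}. real (cluster_size n (g n) k) powr r) powr (2 / r) / real n \<le> C"
    and cluster_max:
          "(\<lambda>n. MAX k\<in>{1..G n}. (real (cluster_size n (g n) k))\<^sup>2 / real n) \<longlonglongrightarrow> 0"
    and unif_integrable:
          "((\<lambda>K::real. SUP n\<in>{1..}. SUP i\<in>{1..n}. SUP j\<in>{1..n}.
               \<integral>\<^sup>+\<omega>. ennreal (\<bar>\<phi> (W n i \<omega>) (W n j \<omega>)\<bar> powr r *
                              of_bool (\<bar>\<phi> (W n i \<omega>) (W n j \<omega>)\<bar> > K)) \<partial>M n)
             \<longlongrightarrow> 0) at_top"
  shows
    "big_O_p M
       (\<lambda>n \<omega>. U_stat \<phi> (W n) n \<omega> -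
               2 / real n * (\<Sum>i\<in>{1..n}. avg_proj (M n) S \<phi> (W n) n (g n) i \<omega>))
       (\<lambda>n. real (max_cluster_size n (g n) (G n)) / real n)
     \<and>
     big_O_p M (\<lambda>n. U_stat \<phi> (W n) n)
       (\<lambda>n. sqrt (real (max_cluster_size n (g n) (G n)) / real n))
     \<and>
     small_o_p M (\<lambda>n. U_stat \<phi> (W n) n) (\<lambda>n. 1)
     \<and>
     (\<forall>lam>0. (\<forall>\<^sub>F n in sequentially. sigma_U (M n) S \<phi> (W n) n (g n) (G n) \<ge> lam) \<longrightarrow>
        weak_conv_m
          (\<lambda>n. distr (M n) borel
             (\<lambda>\<omega>. sqrt (real n) * U_stat \<phi> (W n) n \<omega> / sigma_U (M n) S \<phi> (W n) n (g n) (G n)))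
          std_normal_distribution)"
proof -
  let ?\<phi> = "\<lambda>n i j \<omega>. \<phi> (W n i \<omega>) (W n j \<omega>)"
  let ?m = "\<lambda>n. max_cluster_size n (g n) (G n)"
  have meas: "?\<phi> n i j \<in> borel_measurable (M n)" if "n \<ge> 1" "i \<in> {1..n}" "j \<in> {1..n}" for n i j
    using measurable_compose[OF measurable_Pair[OF W[OF that(1,2)] W[OF that(1,3)]] phi_measurable] by simp

  \<comment> \<open>One \<open>K\<close> serves all sample sizes and pairs because the hypothesis
    bounds a supremum. Requiring \<open>K \<ge> 1\<close> ensures
    \<open>x\<^sup>2 \<le> \<bar>x\<bar> powr r\<close> above the threshold.\<close>
  have UI: "\<exists>K\<ge>1. \<forall>n\<ge>1. \<forall>i\<in>{1..n}. \<forall>j\<in>{1..n}.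
      integrable (M n) (\<lambda>\<omega>. \<bar>?\<phi> n i j \<omega>\<bar> powr r * of_bool (\<bar>?\<phi> n i j \<omega>\<bar> > K)) \<and>
      (\<integral>\<omega>. \<bar>?\<phi> n i j \<omega>\<bar> powr r * of_bool (\<bar>?\<phi> n i j \<omega>\<bar> > K) \<partial>M n) \<le> \<delta>"
    if \<delta>: "\<delta> > 0" for \<delta> :: real
  proof -
    let ?N = "\<lambda>K n i j. \<integral>\<^sup>+\<omega>. ennreal (\<bar>?\<phi> n i j \<omega>\<bar> powr r * of_bool (\<bar>?\<phi> n i j \<omega>\<bar> > K)) \<partial>M n"
    have "\<forall>\<^sub>F K in at_top. (SUP n\<in>{1..}. SUP i\<in>{1..n}. SUP j\<in>{1..n}. ?N K n i j) < ennreal \<delta> \<and> 1 \<le> K"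
      using order_tendstoD(2)[OF unif_integrable, of "ennreal \<delta>"] \<delta> eventually_ge_at_top[of "1::real"]
      by (auto intro: eventually_conj)
    then obtain K where K: "(SUP n\<in>{1..}. SUP i\<in>{1..n}. SUP j\<in>{1..n}. ?N K n i j) < ennreal \<delta>" "1 \<le> K"
      using eventually_happens'[OF trivial_limit_at_top_linorder] by blast
    have le: "?N K n i j \<le> ennreal \<delta>" if "n \<ge> 1" "i \<in> {1..n}" "j \<in> {1..n}" for n i j
    proof -
      have "?N K n i j \<le> (SUP n\<in>{1..}. SUP i\<in>{1..n}. SUP j\<in>{1..n}. ?N K n i j)"
        using that by (intro SUP_upper2[of n] SUP_upper2[of i] SUP_upper2[of j]) auto
      with K show ?thesis by simp
    qed
    show ?thesis
    proof (intro exI[of _ K] conjI K allI impI ballI)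
      fix n i j :: nat assume nij: "n \<ge> 1" "i \<in> {1..n}" "j \<in> {1..n}"
      have "(\<lambda>\<omega>. \<bar>?\<phi> n i j \<omega>\<bar> powr r * of_bool (\<bar>?\<phi> n i j \<omega>\<bar> > K)) \<in> borel_measurable (M n)"
        using meas[OF nij] by measurable
      note * = integrable_expectation_le_if_nn_integral_le[OF this _ le[OF nij]]
      show "integrable (M n) (\<lambda>\<omega>. \<bar>?\<phi> n i j \<omega>\<bar> powr r * of_bool (\<bar>?\<phi> n i j \<omega>\<bar> > K))"
        using \<delta> by (intro *) auto
      show "(\<integral>\<omega>. \<bar>?\<phi> n i j \<omega>\<bar> powr r * of_bool (\<bar>?\<phi> n i j \<omega>\<bar> > K) \<partial>M n) \<le> \<delta>"
        using \<delta> by (intro *) auto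
    qed
  qed

  \<comment> \<open>\<open>B\<close> is \<open>K\<^sup>2 + 1\<close>, with \<open>K\<close> taken
    for tail mass 1.\<close>
  obtain B where "\<forall>n\<ge>1. \<forall>i\<in>{1..n}. \<forall>j\<in>{1..n}. integrable (M n) (\<lambda>\<omega>. (?\<phi> n i j \<omega>)\<^sup>2) \<and>
      (\<integral>\<omega>. (?\<phi> n i j \<omega>)\<^sup>2 \<partial>M n) \<le> B"
  proof -
    from UI[of 1] obtain K where K: "K \<ge> 1" and UI1: "\<And>n i j. n \<ge> 1 \<Longrightarrow> i \<in> {1..n} \<Longrightarrow> j \<in> {1..n} \<Longrightarrow>
      integrable (M n) (\<lambda>\<omega>. \<bar>?\<phi> n i j \<omega>\<bar> powr r * of_bool (\<bar>?\<phi> n i j \<omega>\<bar> > K)) \<and>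
      (\<integral>\<omega>. \<bar>?\<phi> n i j \<omega>\<bar> powr r * of_bool (\<bar>?\<phi> n i j \<omega>\<bar> > K) \<partial>M n) \<le> 1"
      by auto
    have le: "x\<^sup>2 \<le> K\<^sup>2 + \<bar>x\<bar> powr r * of_bool (\<bar>x\<bar> > K)" for x :: real
    proof (cases "\<bar>x\<bar> > K")
      case True
      have "x\<^sup>2 = \<bar>x\<bar> powr 2" using True K by simp
      also have "\<dots> \<le> \<bar>x\<bar> powr r" using True K r by (intro powr_mono) auto
      finally show ?thesis using True by (simp add: add_increasing)
    next
      case False
      then show ?thesis using K by (simp add: abs_le_square_iff[symmetric])
    qed
    have "integrable (M n) (\<lambda>\<omega>. (?\<phi> n i j \<omega>)\<^sup>2) \<and> (\<integral>\<omega>. (?\<phi> n i j \<omega>)\<^sup>2 \<partial>M n) \<le> K\<^sup>2 + 1"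
      if nij: "n \<ge> 1" "i \<in> {1..n}" "j \<in> {1..n}" for n i j
    proof
      interpret prob_space "M n" using nij by (intro M)
      let ?b = "\<lambda>\<omega>. K\<^sup>2 + \<bar>?\<phi> n i j \<omega>\<bar> powr r * of_bool (\<bar>?\<phi> n i j \<omega>\<bar> > K)"
      have b: "integrable (M n) ?b" using UI1[OF nij] by auto
      show int: "integrable (M n) (\<lambda>\<omega>. (?\<phi> n i j \<omega>)\<^sup>2)"
      proof (rule Bochner_Integration.integrable_bound[OF b])
        show "(\<lambda>\<omega>. (?\<phi> n i j \<omega>)\<^sup>2) \<in> borel_measurable (M n)"
          using meas[OF nij] by measurable
        show "AE \<omega> in M n. norm ((?\<phi> n i j \<omega>)\<^sup>2) \<le> norm (?b \<omega>)"
          using le by (intro AE_I2) (simp add: order_trans[OF le abs_ge_self])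
      qed
      have "expectation (\<lambda>\<omega>. (?\<phi> n i j \<omega>)\<^sup>2) \<le> expectation ?b"
        by (rule integral_mono[OF int b le])
      also have "\<dots> \<le> K\<^sup>2 + 1" using UI1[OF nij] by (simp add: prob_space)
      finally show "expectation (\<lambda>\<omega>. (?\<phi> n i j \<omega>)\<^sup>2) \<le> K\<^sup>2 + 1" .
    qed
    then show ?thesis using that by blast
  qed
  then have sq: "integrable (M n) (\<lambda>\<omega>. (?\<phi> n i j \<omega>)\<^sup>2)" and B: "(\<integral>\<omega>. (?\<phi> n i j \<omega>)\<^sup>2 \<partial>M n) \<le> B"
    if "n \<ge> 1" "i \<in> {1..n}" "j \<in> {1..n}" for n i j
    using that by auto

  have sample: "clustered_sample (M n) S \<phi> (W n) n (g n) (G n)" if "n \<ge> 1" for n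
    using that M W clusters phi_measurable phi_symmetric phi_centred indep sq
    by (intro clustered_sample.intro clustered_sample_axioms.intro) auto
  have B0: "0 \<le> B"
    using order_trans[OF _ B[of 1 1 1]] by simp
  have m_ge_1: "1 \<le> ?m n" and m_le_n: "?m n \<le> n" if "n \<ge> 1" for n
    using clustered_sample.m_ge_1[OF sample[OF that]] clustered_sample.m_le_n[OF sample[OF that]] by auto

  have m2: "(\<lambda>n. (real (?m n))\<^sup>2 / real n) \<longlonglongrightarrow> 0"
  proof (rule Lim_null_comparison[OF _ cluster_max])
    show "\<forall>\<^sub>F n in sequentially. norm ((real (?m n))\<^sup>2 / real n)
        \<le> (MAX k\<in>{1..G n}. (real (cluster_size n (g n) k))\<^sup>2 / real n)"
      using eventually_ge_at_top[of "1::nat"]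
    proof eventually_elim
      case (elim n)
      interpret clustered_sample "M n" S \<phi> "W n" n "g n" "G n" by (rule sample[OF elim])
      obtain k where "k \<in> {1..G n}" "?m n = cluster_size n (g n) k" by (rule max_in_range)
      then show ?case by (auto intro!: Max_ge)
    qed
  qed
  have m1: "(\<lambda>n. real (?m n) / sqrt (real n)) \<longlonglongrightarrow> 0"
    using tendsto_real_sqrt[OF m2] by (simp add: real_sqrt_divide)
  have mn: "(\<lambda>n. sqrt (real (?m n) / real n)) \<longlonglongrightarrow> 0"
  proof -
    have "(\<lambda>n. real (?m n) / real n) \<longlonglongrightarrow> 0"
    proof (rule Lim_null_comparison[OF _ m2])
      show "\<forall>\<^sub>F n in sequentially. norm (real (?m n) / real n) \<le> (real (?m n))\<^sup>2 / real n"
        using eventually_ge_at_top[of "1::nat"]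
      proof eventually_elim
        case (elim n)
        \<comment> \<open>Some cluster is nonempty, so \<open>m \<ge> 1\<close>; this reduces
          \<open>m / n\<close> to \<open>m\<^sup>2 / n\<close>.\<close>
        have "real (?m n) \<le> (real (?m n))\<^sup>2"
          using m_ge_1[OF elim] by (simp add: power2_eq_square)
        then show ?case by (simp add: divide_right_mono)
      qed
    qed
    from tendsto_real_sqrt[OF this] show ?thesis by simp
  qed

  have U_eventually: "\<forall>\<^sub>F n in sequentially. prob_space (M n) \<and> integrable (M n) (U_stat \<phi> (W n) n) \<and>
      0 < sqrt (real (?m n) / real n) \<and>
      (\<integral>\<omega>. \<bar>U_stat \<phi> (W n) n \<omega>\<bar> \<partial>M n) \<le> 18 * sqrt B * sqrt (real (?m n) / real n)"
    using eventually_ge_at_top[of "2::nat"]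
  proof eventually_elim
    case (elim n)
    then have n: "n \<ge> 1" by simp
    interpret clustered_sample "M n" S \<phi> "W n" n "g n" "G n" by (rule sample[OF n])
    show ?case
      using U_stat_bound[OF B[OF n] elim] U_stat_integrable m_ge_1 elim prob_space_axioms by auto
  qed

  have part_a: "big_O_p M
       (\<lambda>n \<omega>. U_stat \<phi> (W n) n \<omega> -
               2 / real n * (\<Sum>i\<in>{1..n}. avg_proj (M n) S \<phi> (W n) n (g n) i \<omega>))
       (\<lambda>n. real (?m n) / real n)"
  proof (rule big_O_p_expectation[where c = "16 * sqrt B"])
    show "\<forall>\<^sub>F n in sequentially. prob_space (M n) \<and>
      integrable (M n) (\<lambda>\<omega>. U_stat \<phi> (W n) n \<omega> -
               2 / real n * (\<Sum>i\<in>{1..n}. avg_proj (M n) S \<phi> (W n) n (g n) i \<omega>)) \<and>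
      0 < real (?m n) / real n \<and>
      (\<integral>\<omega>. \<bar>U_stat \<phi> (W n) n \<omega> -
               2 / real n * (\<Sum>i\<in>{1..n}. avg_proj (M n) S \<phi> (W n) n (g n) i \<omega>)\<bar> \<partial>M n)
        \<le> 16 * sqrt B * (real (?m n) / real n)"
      using eventually_ge_at_top[of "2::nat"]
    proof eventually_elim
      case (elim n)
      then have n: "n \<ge> 1" by simp
      interpret clustered_sample "M n" S \<phi> "W n" n "g n" "G n" by (rule sample[OF n])
      let ?D = "\<lambda>\<omega>. U_stat \<phi> (W n) n \<omega> - 2 / real n * (\<Sum>i\<in>{1..n}. proj i \<omega>)"
      have D: "integrable (M n) ?D"
        by (intro Bochner_Integration.integrable_diff U_stat_integrable integrable_mult_right
            Bochner_Integration.integrable_sum proj_integrable)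
      have "expectation (\<lambda>\<omega>. \<bar>?D \<omega>\<bar>) = expectation (\<lambda>\<omega>. \<bar>U_stat \<phi> (W n) n \<omega> - linear_part \<omega>\<bar>)"
      proof (rule integral_cong_AE)
        show "(\<lambda>\<omega>. \<bar>?D \<omega>\<bar>) \<in> borel_measurable (M n)"
          by (rule borel_measurable_integrable[OF integrable_abs[OF D]])
        show "(\<lambda>\<omega>. \<bar>U_stat \<phi> (W n) n \<omega> - linear_part \<omega>\<bar>) \<in> borel_measurable (M n)"
          using U_stat_integrable linear_part_integrable by auto
        show "AE \<omega> in M n. \<bar>?D \<omega>\<bar> = \<bar>U_stat \<phi> (W n) n \<omega> - linear_part \<omega>\<bar>"
          using linear_part_AE by eventually_elim (simp only:)
      qed
      also have "\<dots> \<le> 16 * sqrt B * (real (?m n) / real n)"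
        by (rule U_stat_minus_linear_part_bound[OF B[OF n] elim])
      finally show ?case
        using D m_ge_1 elim prob_space_axioms by auto
    qed
  qed (use B0 in simp)

  have part_b: "big_O_p M (\<lambda>n. U_stat \<phi> (W n) n) (\<lambda>n. sqrt (real (?m n) / real n))"
    using B0 U_eventually by (intro big_O_p_expectation[where c = "18 * sqrt B"]) auto

  have part_b': "small_o_p M (\<lambda>n. U_stat \<phi> (W n) n) (\<lambda>n. 1)"
  proof (rule small_o_p_expectation)
    show "\<forall>\<^sub>F n in sequentially. prob_space (M n) \<and> integrable (M n) (U_stat \<phi> (W n) n) \<and>
        (\<integral>\<omega>. \<bar>U_stat \<phi> (W n) n \<omega>\<bar> \<partial>M n) \<le> 18 * sqrt B * sqrt (real (?m n) / real n)"
      using U_eventually by eventually_elim simp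
    show "(\<lambda>n. 18 * sqrt B * sqrt (real (?m n) / real n)) \<longlonglongrightarrow> 0"
      by (rule tendsto_mult_right_zero[OF mn])
  qed

  have part_c: "weak_conv_m
          (\<lambda>n. distr (M n) borel
             (\<lambda>\<omega>. sqrt (real n) * U_stat \<phi> (W n) n \<omega> / sigma_U (M n) S \<phi> (W n) n (g n) (G n)))
          std_normal_distribution"
    if lam: "lam > 0" and sigma: "\<forall>\<^sub>F n in sequentially. sigma_U (M n) S \<phi> (W n) n (g n) (G n) \<ge> lam" for lam :: real
  proof -
    let ?\<sigma> = "\<lambda>n. sigma_U (M n) S \<phi> (W n) n (g n) (G n)"
    define T where "T n = distr (M n) borel (\<lambda>\<omega>. sqrt (real n) * U_stat \<phi> (W n) n \<omega> / ?\<sigma> n)" for n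
    \<comment> \<open>The Lindeberg sum of the normalised totals, with the truncation rewritten in
      terms of \<open>Y\<close>.\<close>
    define L where "L \<epsilon> n = 4 / (real n * (?\<sigma> n)\<^sup>2) * (\<Sum>k\<in>{1..G n}. \<integral>\<omega>. (clustered_sample.Y (M n) \<phi> (W n) n (g n) k \<omega>)\<^sup>2 *
      of_bool (\<bar>clustered_sample.Y (M n) \<phi> (W n) n (g n) k \<omega>\<bar> > \<epsilon> * ?\<sigma> n / 2 * sqrt (real n)) \<partial>M n)" for \<epsilon> n

    have L_le: "\<forall>\<^sub>F n in sequentially. \<bar>L \<epsilon> n\<bar> < \<delta>" if \<epsilon>: "\<epsilon> > 0" and \<delta>: "\<delta> > 0" for \<epsilon> \<delta> :: real
    proof -
      \<comment> \<open>As \<open>?\<sigma> n \<ge> lam\<close>, the truncation level in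
        \<open>L\<close> is at least \<open>\<eta> * sqrt n\<close>. The constant \<open>c\<close>
        collects what multiplies \<open>\<tau>\<close> in the final bound, and \<open>\<tau>\<close>
        is chosen so that \<open>c * \<tau> < \<delta>\<close> even when
        \<open>c = 0\<close>.\<close>
      define \<eta> where "\<eta> = \<epsilon> * lam / 2"
      have \<eta>: "\<eta> > 0" using \<epsilon> lam by (simp add: \<eta>_def)
      define c where "c = 4 / lam\<^sup>2 * (\<eta> powr (2 - r) * 2 powr r * C powr (r / 2))"
      have c: "c \<ge> 0" by (simp add: c_def)
      define \<tau> where "\<tau> = \<delta> / (2 * (c + 1))"
      have \<tau>: "\<tau> > 0" using c \<delta> by (simp add: \<tau>_def)
      from UI[OF \<tau>] obtain K where K: "K \<ge> 1" and UIK: "\<And>n i j. n \<ge> 1 \<Longrightarrow> i \<in> {1..n} \<Longrightarrow> j \<in> {1..n} \<Longrightarrow>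
          integrable (M n) (\<lambda>\<omega>. \<bar>?\<phi> n i j \<omega>\<bar> powr r * of_bool (\<bar>?\<phi> n i j \<omega>\<bar> > K)) \<and>
          (\<integral>\<omega>. \<bar>?\<phi> n i j \<omega>\<bar> powr r * of_bool (\<bar>?\<phi> n i j \<omega>\<bar> > K) \<partial>M n) \<le> \<tau>"
        by auto
      \<comment> \<open>Equivalent to \<open>2 * K * m < \<eta> * sqrt n\<close>, the level
        condition of \<open>truncated_Y_square_sum\<close>; \<open>K\<close> is already fixed when
        \<open>n\<close> grows.\<close>
      have "\<forall>\<^sub>F n in sequentially. real (?m n) / sqrt (real n) < \<eta> / (2 * K)"
        using order_tendstoD(2)[OF m1, of "\<eta> / (2 * K)"] \<eta> K by simp
      then show ?thesis
        using sigma eventually_ge_at_top[of "1::nat"]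
      proof eventually_elim
        case (elim n)
        interpret clustered_sample "M n" S \<phi> "W n" n "g n" "G n" by (rule sample[OF elim(3)])
        let ?a = "\<eta> * sqrt (real n)"
        have n: "real n > 0" using elim by simp
        have soft: "max (\<bar>x\<bar> - K) 0 powr r \<le> \<bar>x\<bar> powr r * of_bool (\<bar>x\<bar> > K)" for x :: real
          using K r by (auto simp: max_def intro: powr_mono2)
        have soft_int: "integrable (M n) (\<lambda>\<omega>. max (\<bar>?\<phi> n i j \<omega>\<bar> - K) 0 powr r)"
          and soft_le: "expectation (\<lambda>\<omega>. max (\<bar>?\<phi> n i j \<omega>\<bar> - K) 0 powr r) \<le> \<tau>"
          if ij: "i \<in> {1..n}" "j \<in> {1..n}" for i j
        proof -
          note u = UIK[OF elim(3) ij]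
          show i: "integrable (M n) (\<lambda>\<omega>. max (\<bar>?\<phi> n i j \<omega>\<bar> - K) 0 powr r)"
          proof (rule Bochner_Integration.integrable_bound[OF conjunct1[OF u]])
            show "(\<lambda>\<omega>. max (\<bar>?\<phi> n i j \<omega>\<bar> - K) 0 powr r) \<in> borel_measurable (M n)"
              using meas[OF elim(3) ij] by measurable
          qed (use soft in simp)
          have "expectation (\<lambda>\<omega>. max (\<bar>?\<phi> n i j \<omega>\<bar> - K) 0 powr r)
              \<le> expectation (\<lambda>\<omega>. \<bar>?\<phi> n i j \<omega>\<bar> powr r * of_bool (\<bar>?\<phi> n i j \<omega>\<bar> > K))"
            by (rule integral_mono[OF i conjunct1[OF u] soft])
          with u show "expectation (\<lambda>\<omega>. max (\<bar>?\<phi> n i j \<omega>\<bar> - K) 0 powr r) \<le> \<tau>" by simp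
        qed
        have size_sum: "(\<Sum>k\<in>{1..G n}. real (size k) powr r) \<le> (C * real n) powr (r / 2)"
        proof -
          let ?s = "\<Sum>k\<in>{1..G n}. real (size k) powr r"
          have s0: "0 \<le> ?s" by (simp add: sum_nonneg)
          have "?s = (?s powr (2 / r)) powr (r / 2)"
            using s0 r by (simp add: powr_powr)
          also have "\<dots> \<le> (C * real n) powr (r / 2)"
            using cluster_sum[OF elim(3)] n r by (intro powr_mono2) (auto simp: field_simps)
          finally show ?thesis .
        qed
        have C0: "C \<ge> 0"
          by (rule order_trans[OF _ cluster_sum[OF elim(3)]]) simp
        \<comment> \<open>The exponents of \<open>n\<close>, \<open>(2 - r) / 2\<close> from the
          level and \<open>r / 2\<close> from the cluster sizes, add up to 1 and cancel the factor
          \<open>1 / n\<close> in \<open>L\<close>.\<close>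
        have scale: "?a powr (2 - r) * (C * real n) powr (r / 2) = \<eta> powr (2 - r) * C powr (r / 2) * real n"
        proof -
          have "?a powr (2 - r) = \<eta> powr (2 - r) * real n powr ((2 - r) / 2)"
            using \<eta> n by (simp add: powr_mult powr_half_sqrt[symmetric] powr_powr)
          moreover have "(C * real n) powr (r / 2) = C powr (r / 2) * real n powr (r / 2)"
            using C0 by (simp add: powr_mult)
          moreover have "real n powr ((2 - r) / 2) * real n powr (r / 2) = real n"
            using n by (simp flip: powr_add add: diff_divide_distrib)
          ultimately show ?thesis by (simp add: mult_ac)
        qed
        have "(\<Sum>k\<in>{1..G n}. expectation (\<lambda>\<omega>. (Y k \<omega>)\<^sup>2 * of_bool (\<bar>Y k \<omega>\<bar> > ?a)))
            \<le> ?a powr (2 - r) * 2 powr r * \<tau> * (\<Sum>k\<in>{1..G n}. real (size k) powr r)"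
        proof (rule truncated_Y_square_sum[OF r])
          show "2 * K * real (?m n) \<le> ?a"
            using elim(1) K n by (simp add: field_simps)
        qed (use K \<eta> n soft_int soft_le in auto)
        also have "\<dots> \<le> ?a powr (2 - r) * 2 powr r * \<tau> * (C * real n) powr (r / 2)"
          using \<tau> by (intro mult_left_mono size_sum) auto
        also have "\<dots> = 2 powr r * \<tau> * (\<eta> powr (2 - r) * C powr (r / 2) * real n)"
          unfolding scale[symmetric] by (simp add: mult_ac)
        finally have Ya: "(\<Sum>k\<in>{1..G n}. expectation (\<lambda>\<omega>. (Y k \<omega>)\<^sup>2 * of_bool (\<bar>Y k \<omega>\<bar> > ?a)))
            \<le> 2 powr r * \<tau> * (\<eta> powr (2 - r) * C powr (r / 2) * real n)" .
        \<comment> \<open>Lowering the truncation level to \<open>?a\<close> only enlarges the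
          truncated moments.\<close>
        have "(\<Sum>k\<in>{1..G n}. expectation (\<lambda>\<omega>. (Y k \<omega>)\<^sup>2 * of_bool (\<bar>Y k \<omega>\<bar> > \<epsilon> * ?\<sigma> n / 2 * sqrt (real n))))
            \<le> (\<Sum>k\<in>{1..G n}. expectation (\<lambda>\<omega>. (Y k \<omega>)\<^sup>2 * of_bool (\<bar>Y k \<omega>\<bar> > ?a)))"
        proof (intro sum_mono integral_mono')
          fix k assume k: "k \<in> {1..G n}"
          show "integrable (M n) (\<lambda>\<omega>. (Y k \<omega>)\<^sup>2 * of_bool (\<bar>Y k \<omega>\<bar> > ?a))"
          proof (rule Bochner_Integration.integrable_bound[OF Y_square(1)[OF B[OF elim(3)] k]])
            show "(\<lambda>\<omega>. (Y k \<omega>)\<^sup>2 * of_bool (\<bar>Y k \<omega>\<bar> > ?a)) \<in> borel_measurable (M n)"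
              using Y_measurable by measurable
          qed auto
          have "?a \<le> \<epsilon> * ?\<sigma> n / 2 * sqrt (real n)"
            unfolding \<eta>_def using elim(2) \<epsilon> by (intro mult_right_mono) auto
          then show "(Y k \<omega>)\<^sup>2 * of_bool (\<bar>Y k \<omega>\<bar> > \<epsilon> * ?\<sigma> n / 2 * sqrt (real n))
              \<le> (Y k \<omega>)\<^sup>2 * of_bool (\<bar>Y k \<omega>\<bar> > ?a)" for \<omega>
            by auto
        qed auto
        also note Ya
        finally have "L \<epsilon> n \<le> 4 / (real n * (?\<sigma> n)\<^sup>2) * (2 powr r * \<tau> * (\<eta> powr (2 - r) * C powr (r / 2) * real n))"
          unfolding L_def by (intro mult_left_mono) auto
        also have "\<dots> \<le> 4 / (real n * lam\<^sup>2) * (2 powr r * \<tau> * (\<eta> powr (2 - r) * C powr (r / 2) * real n))"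
          using n elim(2) lam \<tau>
          by (intro mult_right_mono divide_left_mono mult_left_mono power_mono mult_pos_pos) auto
        also have "\<dots> = c * \<tau>"
          unfolding c_def using n by (simp add: mult_ac)
        also have "\<dots> < \<delta>"
        proof -
          have "c * \<delta> < \<delta> * (2 * (c + 1))"
            using c \<delta> by (simp add: algebra_simps add_nonneg_pos)
          then show ?thesis
            unfolding \<tau>_def using c by (simp add: divide_less_eq)
        qed
        finally have "L \<epsilon> n < \<delta>" .
        moreover have "0 \<le> L \<epsilon> n"
          unfolding L_def by (intro mult_nonneg_nonneg sum_nonneg integral_nonneg_AE) auto
        ultimately show "\<bar>L \<epsilon> n\<bar> < \<delta>" by simp
      qed
    qed
    then have L_lim: "L \<epsilon> \<longlonglongrightarrow> 0" if "\<epsilon> > 0" for \<epsilon>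
      using that by (intro tendstoI) (simp add: dist_real_def)

    have char_T: "(\<lambda>n. char (T n) t) \<longlonglongrightarrow> char std_normal_distribution t" for t
    proof (rule tendstoI)
      fix e :: real assume e: "e > 0"
      define A where "A = \<bar>t\<bar> ^ 3 / 6 + t ^ 4 / 4"
      have A: "A \<ge> 0" by (simp add: A_def)
      \<comment> \<open>The cap at 1 gives \<open>\<epsilon>\<^sup>2 \<le> \<epsilon>\<close>, so
        the terms that do not vanish with \<open>n\<close> are at most
        \<open>A * \<epsilon> < e\<close>. With this \<open>\<epsilon>\<close> fixed,
        \<open>L \<epsilon>\<close> and the approximation error tend to 0.\<close>
      define \<epsilon> where "\<epsilon> = min 1 (e / (A + 1))"
      have \<epsilon>: "\<epsilon> > 0" "\<epsilon> \<le> 1" using e A by (auto simp: \<epsilon>_def)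
      have "\<epsilon>\<^sup>2 \<le> \<epsilon>" using \<epsilon> by (simp add: power2_eq_square mult_left_le)
      then have "\<bar>t\<bar> ^ 3 * \<epsilon> / 6 + t ^ 4 / 4 * \<epsilon>\<^sup>2 \<le> \<bar>t\<bar> ^ 3 * \<epsilon> / 6 + t ^ 4 / 4 * \<epsilon>"
        by (intro add_left_mono mult_left_mono) auto
      also have "\<dots> = A * \<epsilon>" by (simp add: A_def algebra_simps)
      also have "\<dots> \<le> A * (e / (A + 1))" using A by (intro mult_left_mono) (auto simp: \<epsilon>_def)
      also have "\<dots> < e" using A e by (simp add: field_simps)
      finally have lt: "\<bar>t\<bar> ^ 3 * \<epsilon> / 6 + t ^ 4 / 4 * \<epsilon>\<^sup>2 < e" .
      let ?b = "\<lambda>n. \<bar>t\<bar> ^ 3 * \<epsilon> / 6 + t\<^sup>2 * L \<epsilon> n + t ^ 4 / 4 * (\<epsilon>\<^sup>2 + L \<epsilon> n)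
        + \<bar>t\<bar> * (16 * sqrt B * (real (?m n) / sqrt (real n)) / lam)"
      have "?b \<longlonglongrightarrow> \<bar>t\<bar> ^ 3 * \<epsilon> / 6 + t\<^sup>2 * 0 + t ^ 4 / 4 * (\<epsilon>\<^sup>2 + 0) + \<bar>t\<bar> * (16 * sqrt B * 0 / lam)"
        by (intro tendsto_intros L_lim \<epsilon> m1) (use lam in simp)
      then have "\<forall>\<^sub>F n in sequentially. ?b n < e"
        using lt by (intro order_tendstoD(2)) auto
      then show "\<forall>\<^sub>F n in sequentially. dist (char (T n) t) (char std_normal_distribution t) < e"
        using sigma eventually_ge_at_top[of "2::nat"]
      proof eventually_elim
        case (elim n)
        then have n: "n \<ge> 1" by simp
        interpret clustered_sample "M n" S \<phi> "W n" n "g n" "G n" by (rule sample[OF n])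
        have \<sigma>: "?\<sigma> n > 0" using elim lam by simp
        have "cmod (char (T n) t - exp (- (t\<^sup>2) / 2))
          \<le> \<bar>t\<bar> ^ 3 * \<epsilon> / 6 + t\<^sup>2 * L \<epsilon> n + t ^ 4 / 4 * (\<epsilon>\<^sup>2 + L \<epsilon> n)
            + \<bar>t\<bar> * (16 * sqrt B * (real (?m n) / sqrt (real n)) / ?\<sigma> n)"
          unfolding T_def by (rule standardised_char_bound[OF B[OF n] elim(3) \<sigma> \<epsilon>(1)]) (simp_all add: L_def)
        \<comment> \<open>Replacing \<open>?\<sigma> n\<close> by its lower bound \<open>lam\<close>
          leaves a bound whose limit is known.\<close>
        also have "\<dots> \<le> ?b n"
          using B0 lam elim(2) \<sigma>
          by (intro add_left_mono mult_left_mono divide_left_mono mult_nonneg_nonneg mult_pos_pos) auto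
        also have "\<dots> < e" by (rule elim(1))
        finally show ?case
          by (simp add: dist_norm char_std_normal_distribution)
      qed
    qed

    have "weak_conv_m (\<lambda>n. T (Suc n)) std_normal_distribution"
    proof (rule levy_continuity)
      fix n
      interpret clustered_sample "M (Suc n)" S \<phi> "W (Suc n)" "Suc n" "g (Suc n)" "G (Suc n)"
        by (rule sample) simp
      show "real_distribution (T (Suc n))"
        unfolding T_def using U_stat_integrable by (intro real_distribution_distr) simp
    next
      show "(\<lambda>n. char (T (Suc n)) t) \<longlonglongrightarrow> char std_normal_distribution t" for t
        by (rule LIMSEQ_Suc[OF char_T])
    qed (rule real_dist_normal_dist)
    then show ?thesis
      unfolding T_def[symmetric] by (rule weak_conv_m_from_Suc)
  qed

  show ?thesis
    using part_a part_b part_b' part_c by blast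
qed

end
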